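(* Let $q,d,r$ be positive integers with $1\leq q<d$, let $\Phi=(\varphi_1,\ldots,\varphi_q)$ be a $q$-tuple of holomorphic functions on $\mathbb D^d$, let $F=(f_1,\ldots,f_r)$ with $f_1,\ldots,f_r\in\mathcal D_\infty(\Phi)$, and let $$\mathcal M_\Phi(F)=\overline{\operatorname{span}}\{\Phi^\alpha f_j:\alpha\in\mathbb N_0^q,\ 1\leq j\leq r\}$$ (closure in $H^2(\mathbb D^d)$). Let $\mathbf N=(N_1,\ldots,N_d)$ be positive integers. Then the space $\mathcal M_{\mathbf N}=\pi_{\mathbf N}(\mathcal M_\Phi(F))\subseteq\mathcal A_{\mathbf N}$ satisfies $$\operatorname{codim}_{\mathcal A_{\mathbf N}}\mathcal M_{\mathbf N}\ \geq\ \prod_{\ell=1}^dN_\ell-r\binom{L_{\mathbf N}+q-1}{q},\qquad\text{where } L_{\mathbf N}=1+\sum_{\ell=1}^d(N_\ell-1).$$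
   Context: $\mathbb D\subset\mathbb C$ is the open unit disk, $\mathbb D^d$ is the polydisk, and $\mathbb N_0=\{0,1,2,\ldots\}$. The Hardy space $H^2(\mathbb D^d)$ is the Hilbert space of holomorphic functions $f(z)=\sum_{\alpha\in\mathbb N_0^d}a_\alpha z^\alpha$ on $\mathbb D^d$ with $\|f\|^2=\sum_\alpha|a_\alpha|^2<\infty$, where $z^\alpha=z_1^{\alpha_1}\cdots z_d^{\alpha_d}$. For a tuple $\Phi=(\varphi_1,\ldots,\varphi_q)$ of holomorphic functions on $\mathbb D^d$ and $\alpha\in\mathbb N_0^q$, put $\Phi^\alpha=\prod_{\ell=1}^q\varphi_\ell^{\alpha_\ell}$ and $$\mathcal D_\infty(\Phi)=\{f\in H^2(\mathbb D^d):\Phi^\alpha f\in H^2(\mathbb D^d)\text{ for every }\alpha\in\mathbb N_0^q\}.$$ For $\mathbf N=(N_1,\ldots,N_d)$ positive integers, $\mathcal A_{\mathbf N}=\mathbb C[x_1,\ldots,x_d]/(x_1^{N_1},\ldots,x_d^{N_d})$, of complex dimension $\prod_\ell N_\ell$, and the Taylor truncation $\pi_{\mathbf N}$ sends a holomorphic function $\sum_{\alpha\in\mathbb N_0^d}a_\alpha z^\alpha$ on $\mathbb D^d$ to $\sum_{\alpha:\ \alpha_\ell<N_\ell\ \forall\ell}a_\alpha x^\alpha\in\mathcal A_{\mathbf N}$. $\operatorname{codim}_{\mathcal A_{\mathbf N}}$ denotes the codimension of a complex linear subspace of $\mathcal A_{\mathbf N}$. *)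

theory Defs
  imports
    "HOL-Analysis.Analysis"
    "HOL-Library.Function_Algebras"
    "HOL-Library.Poly_Mapping"
    "HOL-Algebra.Embedded_Algebras"
    "HOL-Algebra.QuotRing"
    "HOL-Algebra.Algebraic_Closure_Type"
begin

text \<open>The numbers \<open>d\<close> and \<open>q\<close> are the cardinalities of the finite index types \<open>'d\<close> and \<open>'q\<close>;
  multi-indices are functions \<open>'d \<Rightarrow> nat\<close> and \<open>'q \<Rightarrow> nat\<close>.\<close>

section \<open>The Hardy space of the polydisk\<close>

definition polydisk :: "(complex ^ 'd::finite) set" where
  "polydisk = {z. \<forall>i. norm (z $ i) < 1}"

text \<open>Holomorphy in several variables: the Frechet derivative exists and is complex linear.
  Values outside the polydisk play no role.\<close>

definition holomorphic_on_polydisk :: "(complex ^ 'd::finite \<Rightarrow> complex) \<Rightarrow> bool" where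
  "holomorphic_on_polydisk f \<longleftrightarrow>
     (\<forall>z\<in>polydisk. \<exists>f'. (f has_derivative f') (at z) \<and> Vector_Spaces.linear (*s) (*) f')"

definition mpower :: "complex ^ 'd::finite \<Rightarrow> ('d \<Rightarrow> nat) \<Rightarrow> complex" where
  "mpower z \<alpha> = (\<Prod>i\<in>UNIV. z $ i ^ \<alpha> i)"

text \<open>The coefficient family \<open>a\<close> with \<open>f z = (\<Sum>\<alpha>. a \<alpha> * z\<^sup>\<alpha>)\<close> on the polydisk, which is unique and
  exists for every holomorphic \<open>f\<close>; the series converge unconditionally.\<close>

definition taylor_coeffs :: "(complex ^ 'd::finite \<Rightarrow> complex) \<Rightarrow> ('d \<Rightarrow> nat) \<Rightarrow> complex" where
  "taylor_coeffs f = (THE a. \<forall>z\<in>polydisk. ((\<lambda>\<alpha>. a \<alpha> * mpower z \<alpha>) has_sum f z) UNIV)"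

text \<open>A function on the polydisk is represented by its extension by zero, so that the elements of
  \<open>hardy2\<close> are in bijection with those of the Hardy space.\<close>

definition hardy2 :: "(complex ^ 'd::finite \<Rightarrow> complex) set" where
  "hardy2 = {f. holomorphic_on_polydisk f \<and> (\<forall>z. z \<notin> polydisk \<longrightarrow> f z = 0) \<and>
                (\<lambda>\<alpha>. (norm (taylor_coeffs f \<alpha>))\<^sup>2) summable_on UNIV}"

definition hardy2_norm :: "(complex ^ 'd::finite \<Rightarrow> complex) \<Rightarrow> real" where
  "hardy2_norm f = sqrt (\<Sum>\<^sub>\<infinity>\<alpha>. (norm (taylor_coeffs f \<alpha>))\<^sup>2)"

definition hardy2_closure ::
  "(complex ^ 'd::finite \<Rightarrow> complex) set \<Rightarrow> (complex ^ 'd \<Rightarrow> complex) set" where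
  "hardy2_closure S = {f \<in> hardy2. \<forall>e>0. \<exists>g\<in>S. hardy2_norm (f - g) < e}"

section \<open>Multipliers\<close>

definition tuple_power ::
  "('q::finite \<Rightarrow> complex ^ 'd::finite \<Rightarrow> complex) \<Rightarrow> ('q \<Rightarrow> nat) \<Rightarrow> complex ^ 'd \<Rightarrow> complex" where
  "tuple_power \<Phi> \<alpha> z = (\<Prod>l\<in>UNIV. \<Phi> l z ^ \<alpha> l)"

definition D_infinity ::
  "('q::finite \<Rightarrow> complex ^ 'd::finite \<Rightarrow> complex) \<Rightarrow> (complex ^ 'd \<Rightarrow> complex) set" where
  "D_infinity \<Phi> = {f \<in> hardy2. \<forall>\<alpha>. tuple_power \<Phi> \<alpha> * f \<in> hardy2}"

interpretation fun_space: vector_space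
  "\<lambda>(c::complex) (f :: complex ^ 'd::finite \<Rightarrow> complex) z. c * f z"
  by standard (auto simp: fun_eq_iff algebra_simps)

definition M_space ::
  "('q::finite \<Rightarrow> complex ^ 'd::finite \<Rightarrow> complex) \<Rightarrow> ('r::finite \<Rightarrow> complex ^ 'd \<Rightarrow> complex)
     \<Rightarrow> (complex ^ 'd \<Rightarrow> complex) set" where
  "M_space \<Phi> F = hardy2_closure (fun_space.span {tuple_power \<Phi> \<alpha> * F j | \<alpha> j. True})"

section \<open>The truncation algebra\<close>

text \<open>The polynomial ring \<open>\<complex>[x\<^sub>i | i :: 'd]\<close> is the monoid algebra of the additive monoid
  \<open>'d \<Rightarrow> nat\<close>.\<close>

type_synonym 'd mpoly = "('d \<Rightarrow> nat) \<Rightarrow>\<^sub>0 complex"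

abbreviation mpoly_ring :: "'d mpoly ring" where
  "mpoly_ring \<equiv> ring_of_type_algebra"

definition var_power :: "'d \<Rightarrow> nat \<Rightarrow> 'd mpoly" where
  "var_power i n = Poly_Mapping.single (\<lambda>j. if j = i then n else 0) 1"

definition trunc_ideal :: "('d::finite \<Rightarrow> nat) \<Rightarrow> 'd mpoly set" where
  "trunc_ideal N = Idl\<^bsub>mpoly_ring\<^esub> {var_power i (N i) | i. True}"

definition trunc_algebra :: "('d::finite \<Rightarrow> nat) \<Rightarrow> 'd mpoly set ring" where
  "trunc_algebra N = mpoly_ring Quot trunc_ideal N"

definition trunc_class :: "('d::finite \<Rightarrow> nat) \<Rightarrow> 'd mpoly \<Rightarrow> 'd mpoly set" where
  "trunc_class N p = trunc_ideal N +>\<^bsub>mpoly_ring\<^esub> p"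

text \<open>The image of \<open>\<complex>\<close> in the truncation algebra, as the field of scalars.\<close>

definition trunc_scalars :: "('d::finite \<Rightarrow> nat) \<Rightarrow> 'd mpoly set set" where
  "trunc_scalars N = {trunc_class N (Poly_Mapping.single 0 c) | c. True}"

definition taylor_trunc ::
  "('d::finite \<Rightarrow> nat) \<Rightarrow> (complex ^ 'd \<Rightarrow> complex) \<Rightarrow> 'd mpoly set" where
  "taylor_trunc N f = trunc_class N
     (\<Sum>\<alpha> | \<forall>l. \<alpha> l < N l. Poly_Mapping.single \<alpha> (taylor_coeffs f \<alpha>))"

text \<open>The truncation algebra is finite-dimensional over \<open>\<complex>\<close>, so the codimension of a subspace is
  the difference of the dimensions.\<close>

definition trunc_codim :: "('d::finite \<Rightarrow> nat) \<Rightarrow> 'd mpoly set set \<Rightarrow> nat" where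
  "trunc_codim N W =
     ring.dim (trunc_algebra N) (trunc_scalars N) (carrier (trunc_algebra N)) -
     ring.dim (trunc_algebra N) (trunc_scalars N) W"

end

theory Submission
  imports Defs "HOL-Complex_Analysis.Cauchy_Integral_Formula"
begin

text \<open>
  Subtracting constants from the symbols does not change the span of the functions
  \<open>\<Phi>\<^sup>\<alpha> f\<^sub>j\<close>: by the binomial theorem, \<open>\<Psi>\<^sub>l = \<Phi>\<^sub>l - \<Phi>\<^sub>l(0)\<close> gives the same span
  (\<open>span_tuple_power_shift\<close>). But \<open>\<Psi>\<^sub>l\<close> vanishes at the origin, so \<open>\<Psi>\<^sup>\<beta> f\<^sub>j = O(\<bar>z\<bar>\<^bsup>\<bar>\<beta>\<bar>\<^esup>)\<close>, and
  its Taylor coefficients of total degree below \<open>\<bar>\<beta>\<bar>\<close> are zero. The indices \<open>\<alpha>\<close> with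
  \<open>\<alpha>\<^sub>l < N\<^sub>l\<close> have total degree at most \<open>L - 1\<close>, so \<open>\<Psi>\<^sup>\<beta> f\<^sub>j\<close> is truncated to zero as soon as
  \<open>\<bar>\<beta>\<bar> \<ge> L\<close>. Hence the truncated span is generated by the images of the \<open>\<Psi>\<^sup>\<beta> f\<^sub>j\<close> with
  \<open>\<bar>\<beta>\<bar> < L\<close>, of which there are at most \<open>r\<close> times \<open>L + q - 1\<close> choose \<open>q\<close>. Passing to the
  closure adds nothing to the image: truncation is continuous for the Hardy norm, and a subspace
  spanned by vectors with a common finite support is closed
  (\<open>trunc_coeffs_hardy2_closure_span\<close>). Since the truncation algebra has dimension
  \<open>\<Prod>N\<^sub>l\<close>, this is the claimed bound.

  Two things have to be supplied for this. The first is the theory of Taylor series on the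
  polydisk: \<open>has_sum_taylor_coeffs\<close> says that they exist, and \<open>norm_taylor_coeffs_le\<close> is Cauchy's
  estimate, from which the vanishing of low coefficients follows by letting the radius tend to
  zero. Both are read off from the Cauchy integral over a torus. The second is the linear algebra
  of the truncation algebra: \<open>mem_trunc_ideal_iff\<close> describes the ideal by vanishing coefficients, and with it dimensions over
  the scalars of the quotient become numbers of linearly independent coefficient families
  (\<open>dim_box_class_span\<close>).
\<close>

unbundle no fps_syntax

section \<open>Integration over tori\<close>

text \<open>The uniform distribution on a unit interval that parametrizes the circle. It lives on the whole
  real line with the Borel sets, so that continuous functions of the parameter are measurable
  without restriction.\<close>

definition circle_measure :: "real measure" where
  "circle_measure = uniform_measure lborel {0..1}"

abbreviation torus_measure :: "'i set \<Rightarrow> ('i \<Rightarrow> real) measure" where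
  "torus_measure I \<equiv> PiM I (\<lambda>_. circle_measure)"

lemma space_circle_measure [simp]: "space circle_measure = UNIV"
  by (simp add: circle_measure_def)

lemma sets_circle_measure [simp, measurable_cong]: "sets circle_measure = sets borel"
  by (simp add: circle_measure_def)

lemma emeasure_circle_measure_space [simp]: "emeasure circle_measure UNIV = 1"
  by (simp add: circle_measure_def)

interpretation circle: finite_measure circle_measure
  by standard simp

interpretation torus: product_sigma_finite "\<lambda>_. circle_measure"
  by standard

lemma emeasure_torus_measure_space:
  assumes "finite I"
  shows "emeasure (torus_measure I) (space (torus_measure I)) = 1"
  using torus.emeasure_PiM[OF assms, of "\<lambda>_. UNIV"] by (simp add: space_PiM)

lemma finite_torus_measure: "finite I \<Longrightarrow> finite_measure (torus_measure I)"
  by standard (simp add: emeasure_torus_measure_space)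

lemma integral_circle_measure:
  assumes "continuous_on UNIV f"
  shows "integral\<^sup>L circle_measure f = integral {0..1} (f :: real \<Rightarrow> complex)"
proof -
  have m: "f \<in> borel_measurable lborel"
    using assms borel_measurable_continuous_onI by auto
  have "integral\<^sup>L circle_measure f = (\<integral>x. indicator {0..1} x *\<^sub>R f x \<partial>lborel)"
  proof -
    have dens: "circle_measure = density lborel (\<lambda>x. ennreal (indicator {0..1} x))"
      unfolding circle_measure_def uniform_measure_def
      by (intro arg_cong2[where f = density]) (auto simp: indicator_def fun_eq_iff)
    show ?thesis unfolding dens by (rule integral_density[OF m]) auto
  qed
  also have "\<dots> = integral {0..1} f"
    using set_borel_integral_eq_integral(2)[of "{0..1}" f]
      borel_integrable_compact[of "{0..1}" f] continuous_on_subset[OF assms]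
    by (simp add: set_lebesgue_integral_def set_integrable_def)
  finally show ?thesis .
qed

lemma torus_integrable_bounded:
  fixes h :: "('i \<Rightarrow> real) \<Rightarrow> complex"
  assumes "finite I" "h \<in> borel_measurable (torus_measure I)" "\<And>\<theta>. norm (h \<theta>) \<le> B"
  shows "integrable (torus_measure I) h"
proof -
  interpret finite_measure "torus_measure I" using finite_torus_measure[OF assms(1)] .
  show ?thesis using integrable_const_bound[OF _ assms(2), of B] assms(3) by auto
qed

lemma norm_torus_integral_le:
  fixes h :: "('i \<Rightarrow> real) \<Rightarrow> complex"
  assumes "finite I" "\<And>\<theta>. norm (h \<theta>) \<le> B"
  shows "norm (integral\<^sup>L (torus_measure I) h) \<le> B"
proof -
  interpret finite_measure "torus_measure I" using finite_torus_measure[OF assms(1)] .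
  have B: "0 \<le> B" using assms(2)[of undefined] norm_ge_zero order_trans by blast
  have "norm (integral\<^sup>L (torus_measure I) h) \<le> (\<integral>\<theta>. norm (h \<theta>) \<partial>torus_measure I)"
    by (rule integral_norm_bound)
  also have "\<dots> \<le> (\<integral>\<theta>. B \<partial>torus_measure I)"
    using assms(2) B by (intro integral_mono') auto
  also have "\<dots> = B"
    using emeasure_torus_measure_space[OF assms(1)] by (simp add: measure_def)
  finally show ?thesis .
qed

definition unit_circle_point :: "real \<Rightarrow> complex" where
  "unit_circle_point t = exp (2 * of_real pi * \<i> * of_real t)"

lemma norm_unit_circle_point [simp]: "norm (unit_circle_point t) = 1"
  by (simp add: unit_circle_point_def norm_exp_eq_Re)

lemma unit_circle_point_nonzero [simp]: "unit_circle_point t \<noteq> 0"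
  by (simp add: unit_circle_point_def)

lemma continuous_on_unit_circle_point [continuous_intros]:
  "continuous_on S g \<Longrightarrow> continuous_on S (\<lambda>x. unit_circle_point (g x))"
  unfolding unit_circle_point_def by (intro continuous_intros)

text \<open>Cauchy's formula \<open>h(z) = (2\<pi>i)\<^sup>-\<^sup>1 \<integral> h(u) / (u - z) du\<close>, with \<open>du = 2\<pi>i u dt\<close> on the circle: the
  normalizing factor cancels and the kernel becomes \<open>1 / (1 - z / u)\<close>, which expands into a
  geometric series.\<close>

lemma Cauchy_formula_circle_measure:
  fixes \<rho> :: real
  assumes hol: "h holomorphic_on ball 0 1" and \<rho>: "0 < \<rho>" "\<rho> < 1" and z: "norm z < \<rho>"
  shows "(\<integral>t. h (\<rho> * unit_circle_point t) / (1 - z / (\<rho> * unit_circle_point t)) \<partial>circle_measure) = h z"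
    (is "integral\<^sup>L _ ?k = _")
proof -
  have sub: "cball 0 \<rho> \<subseteq> ball (0::complex) 1" using \<rho> by auto
  have c: "((\<lambda>u. h u / (u - z)) has_contour_integral (2 * of_real pi * \<i> * h z)) (circlepath 0 \<rho>)"
    using z holomorphic_on_subset[OF hol sub] by (intro Cauchy_integral_circlepath_simple) auto
  have ne: "\<rho> * unit_circle_point t - z \<noteq> 0" for t
  proof
    assume "\<rho> * unit_circle_point t - z = 0"
    then have "norm z = norm (\<rho> * unit_circle_point t)" by simp
    then show False using z \<rho> by (simp add: norm_mult)
  qed
  have eq: "h (circlepath 0 \<rho> t) / (circlepath 0 \<rho> t - z) * vector_derivative (circlepath 0 \<rho>) (at t)
      = 2 * of_real pi * \<i> * ?k t" for t
  proof -
    have w: "circlepath 0 \<rho> t = \<rho> * unit_circle_point t"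
      by (simp add: circlepath unit_circle_point_def)
    have v: "vector_derivative (circlepath 0 \<rho>) (at t) = 2 * of_real pi * \<i> * (\<rho> * unit_circle_point t)"
      by (simp add: vector_derivative_circlepath unit_circle_point_def)
    show ?thesis unfolding w v using ne[of t] \<rho> by (simp add: field_simps)
  qed
  have "((\<lambda>t. 2 * of_real pi * \<i> * ?k t) has_integral (2 * of_real pi * \<i> * h z)) {0..1}"
    using c unfolding has_contour_integral eq .
  from has_integral_mult_right[OF this, of "1 / (2 * of_real pi * \<i>)"]
  have hi: "(?k has_integral h z) {0..1}" by simp
  have "continuous_on UNIV (\<lambda>t. h (\<rho> * unit_circle_point t))"
    using \<rho> by (intro continuous_on_compose2[OF holomorphic_on_imp_continuous_on[OF hol]] continuous_intros)
      (auto simp: norm_mult)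
  then have "continuous_on UNIV ?k"
    using ne \<rho> by (intro continuous_intros) (auto simp: field_simps)
  then show ?thesis using integral_circle_measure[of ?k] hi by (simp add: integral_unique)
qed

lemma integral_unit_circle_point_powers:
  "(\<integral>t. unit_circle_point t ^ m / unit_circle_point t ^ n \<partial>circle_measure) = (if m = n then 1 else 0)"
proof -
  define c where "c = 2 * of_real pi * \<i> * (of_nat m - of_nat n :: complex)"
  have eq: "unit_circle_point t ^ m / unit_circle_point t ^ n = exp (c * of_real t)" for t
    unfolding unit_circle_point_def c_def
    by (simp add: exp_of_nat_mult[symmetric] exp_diff[symmetric] algebra_simps)
  have "(\<integral>t. unit_circle_point t ^ m / unit_circle_point t ^ n \<partial>circle_measure)
      = integral {0..1} (\<lambda>t. exp (c * of_real t))"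
    unfolding eq by (rule integral_circle_measure) (intro continuous_intros)
  also have "\<dots> = (if m = n then 1 else 0)"
  proof (cases "m = n")
    case True
    then show ?thesis by (simp add: c_def)
  next
    case False
    then have c: "c \<noteq> 0" by (simp add: c_def)
    have "((\<lambda>t. exp (c * of_real t)) has_integral exp (c * of_real 1) / c - exp (c * of_real 0) / c) {0..1}"
      using c by (intro fundamental_theorem_of_calculus)
        (auto intro!: derivative_eq_intros has_vector_derivative_real_field)
    moreover have "exp c = 1"
      unfolding exp_eq_1 by (auto simp: c_def intro!: exI[of _ "int m - int n"])
    ultimately show ?thesis using False by (simp add: integral_unique)
  qed
  finally show ?thesis .
qed

section \<open>The Cauchy formula on the polydisk\<close>

lemma open_polydisk: "open (polydisk :: (complex ^ 'd::finite) set)"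
proof -
  have eq: "polydisk = (\<Inter>i. {z :: complex ^ 'd. norm (z $ i) < 1})"
    by (auto simp: polydisk_def)
  show ?thesis
    unfolding eq by (intro open_INT open_Collect_less continuous_intros finite ballI)
qed

lemma holomorphic_on_polydisk_continuous:
  "holomorphic_on_polydisk f \<Longrightarrow> continuous_on polydisk f"
  unfolding holomorphic_on_polydisk_def
  by (auto intro!: continuous_at_imp_continuous_on dest: has_derivative_continuous)

text \<open>The slice is \<open>f\<close> composed with an affine complex line. Complex linearity of the derivative of
  \<open>f\<close> is what turns the real chain rule into complex differentiability.\<close>

lemma holomorphic_on_polydisk_slice:
  fixes z :: "complex ^ 'd::finite"
  assumes f: "holomorphic_on_polydisk f" and z: "z \<in> polydisk"
  shows "(\<lambda>w. f (\<chi> j. if j = i then w else z $ j)) holomorphic_on ball 0 1"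
proof (unfold holomorphic_on_def, intro ballI)
  fix w :: complex assume w: "w \<in> ball 0 1"
  define \<gamma> where "\<gamma> = (\<lambda>w. \<chi> j. if j = i then w else z $ j)"
  have "\<gamma> w \<in> polydisk"
    using z w by (auto simp: \<gamma>_def polydisk_def)
  then obtain f' where f': "(f has_derivative f') (at (\<gamma> w))" "Vector_Spaces.linear (*s) (*) f'"
    using f unfolding holomorphic_on_polydisk_def by blast
  have "bounded_linear (\<lambda>h. h *s axis i 1 :: complex ^ 'd)"
    by (intro linear_conv_bounded_linear[THEN iffD1] linearI) (simp_all add: vec_eq_iff algebra_simps)
  then have "((\<lambda>w. (\<chi> j. if j = i then 0 else z $ j) + w *s axis i 1) has_derivative
      (\<lambda>h. 0 + h *s axis i 1)) (at w)"
    by (intro has_derivative_add has_derivative_const bounded_linear_imp_has_derivative)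
  moreover have "\<gamma> = (\<lambda>w. (\<chi> j. if j = i then 0 else z $ j) + w *s axis i 1)"
    by (auto simp: \<gamma>_def vec_eq_iff axis_def)
  ultimately have \<gamma>': "(\<gamma> has_derivative (\<lambda>h. h *s axis i 1)) (at w)" by simp
  interpret L: Vector_Spaces.linear "(*s)" "(*)" f' by fact
  have "((f \<circ> \<gamma>) has_derivative (f' \<circ> (\<lambda>h. h *s axis i 1))) (at w)"
    by (rule diff_chain_at[OF \<gamma>' f'(1)])
  then have "((f \<circ> \<gamma>) has_field_derivative f' (axis i 1)) (at w)"
    by (simp add: has_field_derivative_def o_def L.scale mult.commute[of _ "f' (axis i 1)"])
  then have "(f \<circ> \<gamma>) field_differentiable (at w within ball 0 1)"
    using field_differentiable_at_within field_differentiable_def by blast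
  then show "(\<lambda>w. f (\<chi> j. if j = i then w else z $ j)) field_differentiable (at w within ball 0 1)"
    by (simp add: o_def \<gamma>_def)
qed

definition torus_point :: "real \<Rightarrow> ('d \<Rightarrow> real) \<Rightarrow> complex ^ 'd::finite" where
  "torus_point \<rho> \<theta> = (\<chi> i. \<rho> * unit_circle_point (\<theta> i))"

text \<open>The points of a torus in the coordinates of \<open>I\<close>, with the other coordinates taken from \<open>z\<close>.
  They interpolate between the point \<open>z\<close> and the full torus, which lets Cauchy's formula be applied
  one coordinate at a time.\<close>

definition partial_torus_point ::
    "'d set \<Rightarrow> complex ^ 'd \<Rightarrow> real \<Rightarrow> ('d \<Rightarrow> real) \<Rightarrow> complex ^ 'd::finite" where
  "partial_torus_point I z \<rho> \<theta> = (\<chi> i. if i \<in> I then \<rho> * unit_circle_point (\<theta> i) else z $ i)"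

lemma unit_circle_point_measurable [measurable]:
  "unit_circle_point \<in> borel_measurable borel"
  by (intro borel_measurable_continuous_onI continuous_intros)

lemma borel_measurable_vec:
  fixes g :: "'a \<Rightarrow> complex ^ 'd::finite"
  assumes "\<And>i. (\<lambda>x. g x $ i) \<in> borel_measurable M"
  shows "g \<in> borel_measurable M"
proof (subst borel_measurable_euclidean_space, intro ballI)
  fix b :: "complex ^ 'd" assume "b \<in> Basis"
  then obtain j u where b: "b = axis j u" by (auto simp: Basis_vec_def)
  have [measurable]: "(\<lambda>x. g x $ j) \<in> borel_measurable M" by fact
  show "(\<lambda>x. g x \<bullet> b) \<in> borel_measurable M"
    unfolding b inner_axis by measurable
qed

lemma partial_torus_point_measurable:
  fixes z :: "complex ^ 'd::finite"
  shows "partial_torus_point I z \<rho> \<in> borel_measurable (torus_measure I)"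
proof (rule borel_measurable_vec)
  fix i
  show "(\<lambda>\<theta>. partial_torus_point I z \<rho> \<theta> $ i) \<in> borel_measurable (torus_measure I)"
    by (cases "i \<in> I") (simp_all add: partial_torus_point_def)
qed

lemma partial_torus_point_in_cball:
  fixes z :: "complex ^ 'd::finite"
  assumes "0 \<le> \<rho>" "\<rho> \<le> r" "\<And>i. norm (z $ i) \<le> r"
  shows "partial_torus_point I z \<rho> \<theta> \<in> {w. \<forall>i. norm (w $ i) \<le> r}"
  using assms by (auto simp: partial_torus_point_def norm_mult)

lemma compact_closed_polydisk: "compact {w :: complex ^ 'd::finite. \<forall>i. norm (w $ i) \<le> r}"
proof -
  have "closed (\<Inter>i. {w :: complex ^ 'd. norm (w $ i) \<le> r})"
    by (intro closed_INT ballI closed_Collect_le continuous_intros)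
  moreover have "bounded {w :: complex ^ 'd. \<forall>i. norm (w $ i) \<le> r}"
  proof (rule boundedI)
    fix w :: "complex ^ 'd" assume "w \<in> {w. \<forall>i. norm (w $ i) \<le> r}"
    then have "(\<Sum>i\<in>UNIV. norm (w $ i)) \<le> (\<Sum>i\<in>(UNIV :: 'd set). r)"
      by (intro sum_mono) auto
    then show "norm w \<le> (\<Sum>i\<in>(UNIV :: 'd set). r)"
      unfolding norm_vec_def using L2_set_le_sum[of UNIV "\<lambda>i. norm (w $ i)"] by simp
  qed
  ultimately show ?thesis
    by (simp add: compact_eq_bounded_closed Collect_all_eq)
qed

text \<open>Dominated convergence for unordered sums. The domination by \<open>t\<close> makes the convergence uniform:
  the tail outside a finite set of indices is at most the tail of \<open>t\<close>, at every point and hence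
  also after integration.\<close>

lemma has_sum_torus_integral:
  fixes g :: "'a \<Rightarrow> ('i \<Rightarrow> real) \<Rightarrow> complex"
  assumes I: "finite I" and g: "\<And>a. integrable (torus_measure I) (g a)"
    and G: "integrable (torus_measure I) G"
    and sum: "\<And>\<theta>. ((\<lambda>a. g a \<theta>) has_sum G \<theta>) UNIV"
    and bound: "\<And>a \<theta>. norm (g a \<theta>) \<le> t a" and t: "t summable_on UNIV"
  shows "((\<lambda>a. integral\<^sup>L (torus_measure I) (g a)) has_sum integral\<^sup>L (torus_measure I) G) UNIV"
proof -
  let ?i = "integral\<^sup>L (torus_measure I)"
  have tail: "norm ((\<Sum>a\<in>A. ?i (g a)) - ?i G) \<le> infsum t UNIV - sum t A" if A: "finite A" for A
  proof -
    have pt: "norm (G \<theta> - (\<Sum>a\<in>A. g a \<theta>)) \<le> infsum t UNIV - sum t A" for \<theta>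
    proof (rule norm_infsum_le)
      show "((\<lambda>a. g a \<theta>) has_sum (G \<theta> - (\<Sum>a\<in>A. g a \<theta>))) (UNIV - A)"
        by (rule has_sum_Diff[OF sum]) (use A in auto)
      show "(t has_sum (infsum t UNIV - sum t A)) (UNIV - A)"
        by (rule has_sum_Diff) (use A t in auto)
    qed (use bound in auto)
    have "?i (\<lambda>\<theta>. G \<theta> - (\<Sum>a\<in>A. g a \<theta>)) = ?i G - (\<Sum>a\<in>A. ?i (g a))"
      using G g by (subst Bochner_Integration.integral_diff) auto
    with norm_torus_integral_le[OF I, of "\<lambda>\<theta>. G \<theta> - (\<Sum>a\<in>A. g a \<theta>)", OF pt] show ?thesis by (simp add: norm_minus_commute)
  qed
  have "(sum t \<longlongrightarrow> infsum t UNIV) (finite_subsets_at_top UNIV)"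
    using t by (simp add: has_sum_def[symmetric])
  then have "((\<lambda>A. infsum t UNIV - sum t A) \<longlongrightarrow> infsum t UNIV - infsum t UNIV) (finite_subsets_at_top UNIV)"
    by (intro tendsto_intros)
  then have lim: "((\<lambda>A. infsum t UNIV - sum t A) \<longlongrightarrow> 0) (finite_subsets_at_top UNIV)"
    by simp
  have "((\<lambda>A. (\<Sum>a\<in>A. ?i (g a)) - ?i G) \<longlongrightarrow> 0) (finite_subsets_at_top UNIV)"
    by (rule Lim_null_comparison[OF _ lim]) (auto intro!: eventually_finite_subsets_at_top_weakI tail)
  then show ?thesis unfolding has_sum_def by (simp add: LIM_zero_iff)
qed

text \<open>The product of absolutely convergent geometric series, multiplied out.\<close>

lemma has_sum_multi_geometric:
  fixes u :: "'d::finite \<Rightarrow> complex"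
  assumes "\<And>i. norm (u i) < 1"
  shows "((\<lambda>\<alpha>. \<Prod>i\<in>UNIV. u i ^ \<alpha> i) has_sum (\<Prod>i\<in>UNIV. inverse (1 - u i))) UNIV"
    and "(\<lambda>\<alpha>. \<Prod>i\<in>UNIV. norm (u i) ^ \<alpha> i) summable_on UNIV"
proof -
  have s: "Infinite_Sum.abs_summable_on (\<lambda>n. u i ^ n) UNIV" for i
    using assms[of i] by (intro norm_summable_imp_summable_on) (simp add: norm_power summable_geometric)
  have "Infinite_Sum.abs_summable_on (\<lambda>\<alpha>. \<Prod>i\<in>UNIV. u i ^ \<alpha> i) (PiE UNIV (\<lambda>_. UNIV))"
    unfolding abs_summable_equivalent
    by (rule abs_summable_on_prod_PiE) (use s in \<open>auto simp: abs_summable_equivalent\<close>)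
  then have a: "Infinite_Sum.abs_summable_on (\<lambda>\<alpha>. \<Prod>i\<in>UNIV. u i ^ \<alpha> i) UNIV"
    by simp
  then show "(\<lambda>\<alpha>. \<Prod>i\<in>UNIV. norm (u i) ^ \<alpha> i) summable_on UNIV"
    by (simp add: prod_norm[symmetric] norm_power)
  have one: "infsum (\<lambda>n. u i ^ n) UNIV = inverse (1 - u i)" for i
    using assms[of i] by (intro infsumI norm_summable_imp_has_sum)
      (auto simp: norm_power summable_geometric inverse_eq_divide intro: geometric_sums)
  have "infsum (\<lambda>\<alpha>. \<Prod>i\<in>UNIV. u i ^ \<alpha> i) (PiE UNIV (\<lambda>_. UNIV)) = (\<Prod>i\<in>UNIV. inverse (1 - u i))"
    by (subst infsum_prod_PiE_abs) (use s one in auto)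
  then show "((\<lambda>\<alpha>. \<Prod>i\<in>UNIV. u i ^ \<alpha> i) has_sum (\<Prod>i\<in>UNIV. inverse (1 - u i))) UNIV"
    using has_sum_infsum[OF abs_summable_summable[OF a]] by simp
qed

lemma torus_integrable_partial:
  fixes z :: "complex ^ 'd::finite" and f :: "complex ^ 'd \<Rightarrow> complex"
  assumes f: "continuous_on polydisk f" and \<rho>: "0 < \<rho>" "\<rho> < 1" and z: "z \<in> polydisk"
    and k: "k \<in> borel_measurable (torus_measure I)" "\<And>\<theta>. norm (k \<theta>) \<le> B"
  shows "integrable (torus_measure I) (\<lambda>\<theta>. f (partial_torus_point I z \<rho> \<theta>) * k \<theta>)"
proof -
  define r where "r = Max (insert \<rho> (range (\<lambda>i. norm (z $ i))))"
  have r: "\<rho> \<le> r" "\<And>i. norm (z $ i) \<le> r" "r < 1"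
    using \<rho> z by (auto simp: r_def polydisk_def le_max_iff_disj)
  let ?K = "{w :: complex ^ 'd. \<forall>i. norm (w $ i) \<le> r}"
  have sub: "?K \<subseteq> polydisk" using r(3) by (auto simp: polydisk_def intro: le_less_trans)
  have inK: "partial_torus_point I z \<rho> \<theta> \<in> ?K" for \<theta>
    using partial_torus_point_in_cball[of \<rho> r z I \<theta>] \<rho> r by auto
  have "bounded (f ` ?K)"
    by (intro compact_imp_bounded compact_continuous_image continuous_on_subset[OF f sub] compact_closed_polydisk)
  then obtain C where C: "\<And>w. w \<in> ?K \<Longrightarrow> norm (f w) \<le> C" by (auto simp: bounded_iff)
  have m: "(\<lambda>w. indicator polydisk w *\<^sub>R f w) \<in> borel_measurable borel"
    using f borel_open[OF open_polydisk] by (intro borel_measurable_continuous_on_indicator)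
  have "(\<lambda>\<theta>. indicator polydisk (partial_torus_point I z \<rho> \<theta>) *\<^sub>R f (partial_torus_point I z \<rho> \<theta>))
      \<in> borel_measurable (torus_measure I)"
    by (rule measurable_compose[OF partial_torus_point_measurable m])
  then have fm: "(\<lambda>\<theta>. f (partial_torus_point I z \<rho> \<theta>)) \<in> borel_measurable (torus_measure I)"
    using inK sub by (simp add: subset_iff indicator_def)
  have "norm (f (partial_torus_point I z \<rho> \<theta>) * k \<theta>) \<le> C * B" for \<theta>
    unfolding norm_mult using C[OF inK] k(2)[of \<theta>] order_trans[OF norm_ge_zero C[OF inK]]
    by (intro mult_mono) auto
  then show ?thesis
    by (intro torus_integrable_bounded[where B = "C * B"] borel_measurable_times fm k) auto
qed

text \<open>Induction on the set of coordinates that have been integrated out: Fubini's theorem isolates the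
  new coordinate, in which \<open>f\<close> restricts to a holomorphic function of one variable.\<close>

lemma Cauchy_formula_partial_torus:
  fixes z :: "complex ^ 'd::finite"
  assumes f: "holomorphic_on_polydisk f" and \<rho>: "0 < \<rho>" "\<rho> < 1" and z: "z \<in> polydisk"
    and "\<And>i. i \<in> I \<Longrightarrow> norm (z $ i) < \<rho>"
  shows "(\<integral>\<theta>. f (partial_torus_point I z \<rho> \<theta>)
            * (\<Prod>i\<in>I. inverse (1 - z $ i / (\<rho> * unit_circle_point (\<theta> i)))) \<partial>torus_measure I) = f z"
proof -
  have "finite I" by (rule finite)
  then show ?thesis using assms(5)
  proof (induction I rule: finite_induct)
    case empty
    have "integral\<^sup>L (torus_measure ({} :: 'd set)) (\<lambda>\<theta>. f z) = f z"
      using emeasure_torus_measure_space[of "{} :: 'd set"] by (simp add: measure_def)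
    moreover have "partial_torus_point {} z \<rho> \<theta> = z" for \<theta>
      by (simp add: partial_torus_point_def vec_eq_iff)
    ultimately show ?case by simp
  next
    case (insert i I)
    let ?k = "\<lambda>j \<theta>. inverse (1 - z $ j / (\<rho> * unit_circle_point (\<theta> j)))"
    have kbound: "norm (?k j \<theta>) \<le> inverse (1 - norm (z $ j) / \<rho>)" if "j \<in> insert i I" for j \<theta>
    proof -
      have "norm (z $ j) / \<rho> = norm (z $ j / (\<rho> * unit_circle_point (\<theta> j)))"
        using \<rho> by (simp add: norm_mult norm_divide)
      moreover have "norm (z $ j) / \<rho> < 1" using insert.prems[OF that] \<rho> by simp
      ultimately show ?thesis
        unfolding norm_inverse using norm_triangle_ineq2[of 1 "z $ j / (\<rho> * unit_circle_point (\<theta> j))"]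
        by (intro le_imp_inverse_le) auto
    qed
    have int: "integrable (torus_measure (insert i I))
       (\<lambda>\<theta>. f (partial_torus_point (insert i I) z \<rho> \<theta>) * (\<Prod>j\<in>insert i I. ?k j \<theta>))"
    proof (rule torus_integrable_partial[OF holomorphic_on_polydisk_continuous[OF f] \<rho> z])
      show "(\<lambda>\<theta>. \<Prod>j\<in>insert i I. ?k j \<theta>) \<in> borel_measurable (torus_measure (insert i I))"
        by measurable
      show "norm (\<Prod>j\<in>insert i I. ?k j \<theta>) \<le> (\<Prod>j\<in>insert i I. inverse (1 - norm (z $ j) / \<rho>))" for \<theta>
        unfolding prod_norm[symmetric] using kbound by (intro prod_mono) auto
    qed
    \<comment> \<open>Integrating out the new coordinate is Cauchy's formula in one variable,
        applied to the slice of \<open>f\<close> through \<open>p\<close>.\<close>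
    have inner: "(\<integral>y. f (partial_torus_point (insert i I) z \<rho> (\<theta>(i:=y))) * (\<Prod>j\<in>insert i I. ?k j (\<theta>(i:=y))) \<partial>circle_measure)
        = f (partial_torus_point I z \<rho> \<theta>) * (\<Prod>j\<in>I. ?k j \<theta>)" for \<theta>
    proof -
      define p where "p = partial_torus_point I z \<rho> \<theta>"
      define h where "h = (\<lambda>w. f (\<chi> j. if j = i then w else p $ j))"
      have p: "p \<in> polydisk" "p $ i = z $ i"
        using z \<rho> insert.hyps by (auto simp: p_def partial_torus_point_def polydisk_def norm_mult)
      have h: "h holomorphic_on ball 0 1"
        unfolding h_def by (rule holomorphic_on_polydisk_slice[OF f p(1)])
      have hp: "h (z $ i) = f p"
        unfolding h_def p(2)[symmetric] by (intro arg_cong[where f = f]) (simp add: vec_eq_iff)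
      have eq: "f (partial_torus_point (insert i I) z \<rho> (\<theta>(i:=y))) * (\<Prod>j\<in>insert i I. ?k j (\<theta>(i:=y)))
          = h (\<rho> * unit_circle_point y) / (1 - z $ i / (\<rho> * unit_circle_point y)) * (\<Prod>j\<in>I. ?k j \<theta>)" for y
      proof -
        have "partial_torus_point (insert i I) z \<rho> (\<theta>(i:=y)) = (\<chi> j. if j = i then \<rho> * unit_circle_point y else p $ j)"
          by (auto simp: p_def partial_torus_point_def vec_eq_iff)
        moreover have "(\<Prod>j\<in>I. ?k j (\<theta>(i:=y))) = (\<Prod>j\<in>I. ?k j \<theta>)"
          using insert.hyps by (intro prod.cong) auto
        ultimately show ?thesis using insert.hyps by (simp add: h_def divide_inverse)
      qed
      have "norm (z $ i) < \<rho>" by (rule insert.prems) simp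
      then show ?thesis
        unfolding eq integral_mult_left_zero by (simp only: Cauchy_formula_circle_measure[OF h \<rho>] hp p_def)
    qed
    show ?case
      unfolding torus.product_integral_insert[OF insert.hyps int] inner
      by (rule insert.IH) (use insert.prems in auto)
  qed
qed

section \<open>Taylor series on the polydisk\<close>

text \<open>The Cauchy integral for the Taylor coefficients.\<close>

definition torus_coeff :: "real \<Rightarrow> (complex ^ 'd::finite \<Rightarrow> complex) \<Rightarrow> ('d \<Rightarrow> nat) \<Rightarrow> complex" where
  "torus_coeff \<rho> f \<alpha> = (\<integral>\<theta>. f (torus_point \<rho> \<theta>) / mpower (torus_point \<rho> \<theta>) \<alpha> \<partial>torus_measure UNIV)"

lemma torus_point_eq_partial: "torus_point \<rho> \<theta> = partial_torus_point UNIV 0 \<rho> \<theta>"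
  by (simp add: torus_point_def partial_torus_point_def)

lemma norm_mpower_torus_point:
  "0 < \<rho> \<Longrightarrow> norm (mpower (torus_point \<rho> \<theta>) \<alpha>) = \<rho> ^ sum \<alpha> UNIV"
  by (simp add: mpower_def torus_point_def prod_norm[symmetric] norm_power norm_mult power_sum)

lemma mpower_measurable: "(\<lambda>\<theta>. mpower (torus_point \<rho> \<theta>) \<alpha>) \<in> borel_measurable (torus_measure UNIV)"
  unfolding mpower_def torus_point_def by simp

lemma torus_point_in_polydisk: "0 < \<rho> \<Longrightarrow> \<rho> < 1 \<Longrightarrow> torus_point \<rho> \<theta> \<in> polydisk"
  by (simp add: torus_point_def polydisk_def norm_mult)

lemma bounded_on_torus:
  assumes f: "continuous_on polydisk f" and \<rho>: "0 < \<rho>" "\<rho> < 1"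
  obtains C where "\<And>\<theta>. norm (f (torus_point \<rho> \<theta> :: complex ^ 'd::finite)) \<le> C"
proof -
  let ?K = "{w :: complex ^ 'd. \<forall>i. norm (w $ i) \<le> \<rho>}"
  have sub: "?K \<subseteq> polydisk" using \<rho> by (auto simp: polydisk_def intro: le_less_trans)
  have "bounded (f ` ?K)"
    by (intro compact_imp_bounded compact_continuous_image continuous_on_subset[OF f sub] compact_closed_polydisk)
  then obtain C where C: "\<And>w. w \<in> ?K \<Longrightarrow> norm (f w) \<le> C" by (auto simp: bounded_iff)
  have "norm (f (torus_point \<rho> \<theta>)) \<le> C" for \<theta>
    by (rule C) (use \<rho> in \<open>auto simp: torus_point_def norm_mult\<close>)
  then show ?thesis by (rule that)
qed

lemma torus_integrable:
  fixes f :: "complex ^ 'd::finite \<Rightarrow> complex"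
  assumes "continuous_on polydisk f" "0 < \<rho>" "\<rho> < 1"
    and "k \<in> borel_measurable (torus_measure UNIV)" "\<And>\<theta>. norm (k \<theta>) \<le> B"
  shows "integrable (torus_measure UNIV) (\<lambda>\<theta>. f (torus_point \<rho> \<theta>) * k \<theta>)"
  unfolding torus_point_eq_partial
  by (rule torus_integrable_partial[OF assms(1-3) _ assms(4,5)]) (simp add: polydisk_def)

text \<open>Expand the kernel in the Cauchy formula over the torus into a multiple geometric series and
  integrate term by term. The quotients \<open>z\<^sub>i / w\<^sub>i\<close> have the same modulus everywhere on the torus,
  which dominates the series.\<close>

lemma has_sum_torus_coeff:
  fixes z :: "complex ^ 'd::finite"
  assumes f: "holomorphic_on_polydisk f" and \<rho>: "0 < \<rho>" "\<rho> < 1" and z: "\<And>i. norm (z $ i) < \<rho>"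
  shows "((\<lambda>\<alpha>. torus_coeff \<rho> f \<alpha> * mpower z \<alpha>) has_sum f z) UNIV"
proof -
  note cf = holomorphic_on_polydisk_continuous[OF f]
  obtain C where C: "\<And>\<theta>. norm (f (torus_point \<rho> \<theta>)) \<le> C"
    using bounded_on_torus[OF cf \<rho>] by blast
  have zp: "z \<in> polydisk" using z \<rho> by (auto simp: polydisk_def intro: less_trans)
  define u where "u = (\<lambda>\<theta> i. z $ i / (\<rho> * unit_circle_point (\<theta> i)))"
  have nu: "norm (u \<theta> i) = norm (z $ i) / \<rho>" for \<theta> i
    using \<rho> by (simp add: u_def norm_mult norm_divide)
  have nu1: "norm (z $ i) / \<rho> < 1" for i using z[of i] \<rho> by simp
  define g where "g = (\<lambda>\<alpha> \<theta>. f (torus_point \<rho> \<theta>) * (\<Prod>i\<in>UNIV. u \<theta> i ^ \<alpha> i))"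
  define G where "G = (\<lambda>\<theta>. f (torus_point \<rho> \<theta>) * (\<Prod>i\<in>UNIV. inverse (1 - u \<theta> i)))"
  \<comment> \<open>The moduli of the quotients \<open>u\<close> do not depend on the angles,
      so any angles may be used to state the bound.\<close>
  define t where "t = (\<lambda>\<alpha>. C * (\<Prod>i\<in>UNIV. norm (u (\<lambda>_. 0) i) ^ \<alpha> i))"
  have "((\<lambda>\<alpha>. integral\<^sup>L (torus_measure UNIV) (g \<alpha>)) has_sum integral\<^sup>L (torus_measure UNIV) G) UNIV"
  proof (rule has_sum_torus_integral)
    show "integrable (torus_measure UNIV) (g \<alpha>)" for \<alpha>
      unfolding g_def
    proof (rule torus_integrable[OF cf \<rho>])
      show "(\<lambda>\<theta>. \<Prod>i\<in>UNIV. u \<theta> i ^ \<alpha> i) \<in> borel_measurable (torus_measure UNIV)"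
        unfolding u_def by measurable
      show "norm (\<Prod>i\<in>UNIV. u \<theta> i ^ \<alpha> i) \<le> (\<Prod>i\<in>UNIV. (norm (z $ i) / \<rho>) ^ \<alpha> i)" for \<theta>
        by (simp add: prod_norm[symmetric] norm_power nu)
    qed
    show "integrable (torus_measure UNIV) G"
      unfolding G_def
    proof (rule torus_integrable[OF cf \<rho>])
      show "(\<lambda>\<theta>. \<Prod>i\<in>UNIV. inverse (1 - u \<theta> i)) \<in> borel_measurable (torus_measure UNIV)"
        unfolding u_def by measurable
      have "norm (inverse (1 - u \<theta> i)) \<le> inverse (1 - norm (z $ i) / \<rho>)" for \<theta> i
        unfolding norm_inverse using norm_triangle_ineq2[of 1 "u \<theta> i"] nu1[of i]
        by (intro le_imp_inverse_le) (auto simp: nu)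
      then show "norm (\<Prod>i\<in>UNIV. inverse (1 - u \<theta> i)) \<le> (\<Prod>i\<in>UNIV. inverse (1 - norm (z $ i) / \<rho>))" for \<theta>
        unfolding prod_norm[symmetric] by (intro prod_mono) auto
    qed
    show "((\<lambda>\<alpha>. g \<alpha> \<theta>) has_sum G \<theta>) UNIV" for \<theta>
      unfolding g_def G_def using nu nu1
      by (intro has_sum_cmult_right has_sum_multi_geometric) auto
    show "norm (g \<alpha> \<theta>) \<le> t \<alpha>" for \<alpha> \<theta>
      unfolding g_def t_def norm_mult
      using C[of \<theta>] by (auto simp: prod_norm[symmetric] norm_power nu intro!: mult_right_mono prod_nonneg)
        (use \<rho> in auto)
    show "t summable_on UNIV"
      unfolding t_def using nu nu1
      by (intro summable_on_cmult_right has_sum_multi_geometric) auto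
  qed simp
  moreover have "integral\<^sup>L (torus_measure UNIV) G = f z"
    using Cauchy_formula_partial_torus[OF f \<rho> zp, of UNIV] z
    by (simp add: G_def u_def torus_point_def partial_torus_point_def)
  moreover have "integral\<^sup>L (torus_measure UNIV) (g \<alpha>) = torus_coeff \<rho> f \<alpha> * mpower z \<alpha>" for \<alpha>
  proof -
    have "g \<alpha> = (\<lambda>\<theta>. f (torus_point \<rho> \<theta>) / mpower (torus_point \<rho> \<theta>) \<alpha> * mpower z \<alpha>)"
      by (rule ext) (simp add: g_def u_def mpower_def torus_point_def power_divide prod_dividef)
    then show ?thesis by (simp only: torus_coeff_def integral_mult_left_zero)
  qed
  ultimately show ?thesis by simp
qed

lemma integral_mpower_quotient:
  assumes "0 < \<rho>"
  shows "(\<integral>\<theta>. mpower (torus_point \<rho> \<theta> :: complex ^ 'd::finite) \<beta> / mpower (torus_point \<rho> \<theta>) \<alpha> \<partial>torus_measure UNIV)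
     = (if \<beta> = \<alpha> then 1 else 0)"
proof -
  let ?q = "\<lambda>i t. unit_circle_point t ^ \<beta> i / unit_circle_point t ^ \<alpha> i"
  define c where "c = (\<Prod>i\<in>UNIV. complex_of_real \<rho> ^ \<beta> i / complex_of_real \<rho> ^ \<alpha> i)"
  have eq: "mpower (torus_point \<rho> \<theta>) \<beta> / mpower (torus_point \<rho> \<theta> :: complex ^ 'd) \<alpha>
     = c * (\<Prod>i\<in>UNIV. ?q i (\<theta> i))" for \<theta>
    by (simp only: c_def mpower_def torus_point_def prod_dividef power_mult_distrib prod.distrib
        vec_lambda_beta times_divide_times_eq)
  have "integrable circle_measure (?q i)" for i
    by (rule circle.integrable_const_bound[where B = 1]) (auto simp: norm_divide norm_power)
  then have "(\<integral>\<theta>. (\<Prod>i\<in>UNIV. ?q i (\<theta> i)) \<partial>torus_measure UNIV) = (\<Prod>i\<in>UNIV. if \<beta> i = \<alpha> i then 1 else 0)"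
    by (subst torus.product_integral_prod) (auto simp: integral_unit_circle_point_powers)
  also have "\<dots> = (if \<beta> = \<alpha> then 1 else 0)"
    by (auto simp: fun_eq_iff)
  finally show ?thesis
    using assms unfolding eq by (auto simp: c_def)
qed

text \<open>Uniqueness of power series expansions: integrating the expansion against \<open>w\<^bsup>-\<alpha>\<^esup>\<close> over the torus
  leaves only the coefficient at \<open>\<alpha>\<close>, by orthogonality of the monomials. It suffices that the
  expansion holds on one torus.\<close>

lemma torus_coeff_eqI:
  fixes f :: "complex ^ 'd::finite \<Rightarrow> complex"
  assumes f: "holomorphic_on_polydisk f" and \<rho>: "0 < \<rho>" "\<rho> < 1"
    and b: "\<And>\<theta>. ((\<lambda>\<alpha>. b \<alpha> * mpower (torus_point \<rho> \<theta>) \<alpha>) has_sum f (torus_point \<rho> \<theta>)) UNIV"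
  shows "torus_coeff \<rho> f = b"
proof
  fix \<alpha> :: "'d \<Rightarrow> nat"
  define g where "g = (\<lambda>\<beta> \<theta>. b \<beta> * (mpower (torus_point \<rho> \<theta> :: complex ^ 'd) \<beta> / mpower (torus_point \<rho> \<theta>) \<alpha>))"
  \<comment> \<open>The series converges absolutely at the point of the torus with all angles zero,
      and its terms have the same moduli everywhere on the torus.\<close>
  define t where "t = (\<lambda>\<beta>. norm (b \<beta> * mpower (torus_point \<rho> (\<lambda>_. 0)) \<beta>) * inverse (\<rho> ^ sum \<alpha> UNIV))"
  have ng: "norm (g \<beta> \<theta>) \<le> t \<beta>" for \<beta> \<theta>
    unfolding g_def t_def norm_mult norm_divide norm_mpower_torus_point[OF \<rho>(1)]
    by (simp only: divide_inverse mult.assoc order.refl)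
  have "((\<lambda>\<beta>. integral\<^sup>L (torus_measure UNIV) (g \<beta>)) has_sum torus_coeff \<rho> f \<alpha>) UNIV"
    unfolding torus_coeff_def
  proof (rule has_sum_torus_integral)
    show "integrable (torus_measure UNIV) (g \<beta>)" for \<beta>
      by (rule torus_integrable_bounded[OF _ _ ng])
        (auto simp: g_def intro!: borel_measurable_times borel_measurable_divide mpower_measurable)
    show "integrable (torus_measure UNIV) (\<lambda>\<theta>. f (torus_point \<rho> \<theta>) / mpower (torus_point \<rho> \<theta>) \<alpha>)"
      unfolding divide_inverse
      by (rule torus_integrable[OF holomorphic_on_polydisk_continuous[OF f] \<rho>, where B = "inverse (\<rho> ^ sum \<alpha> UNIV)"])
        (use \<rho> in \<open>auto intro!: borel_measurable_inverse mpower_measurable simp: norm_inverse norm_mpower_torus_point\<close>)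
    show "((\<lambda>\<beta>. g \<beta> \<theta>) has_sum f (torus_point \<rho> \<theta>) / mpower (torus_point \<rho> \<theta>) \<alpha>) UNIV" for \<theta>
      using has_sum_cmult_left[OF b[of \<theta>], of "inverse (mpower (torus_point \<rho> \<theta>) \<alpha>)"]
      by (simp add: g_def divide_inverse mult.assoc)
    have "Infinite_Sum.abs_summable_on (\<lambda>\<beta>. b \<beta> * mpower (torus_point \<rho> (\<lambda>_. 0) :: complex ^ 'd) \<beta>) UNIV"
      using b[of "\<lambda>_. 0"] by (auto simp: summable_on_iff_abs_summable_on_complex[symmetric] summable_on_def)
    then show "t summable_on UNIV"
      unfolding t_def by (rule summable_on_cmult_left)
  qed (use ng in auto)
  moreover have "integral\<^sup>L (torus_measure UNIV) (g \<beta>) = (if \<beta> = \<alpha> then b \<alpha> else 0)" for \<beta>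
    unfolding g_def integral_mult_right_zero integral_mpower_quotient[OF \<rho>(1)] by simp
  ultimately have "((\<lambda>\<beta>. if \<beta> = \<alpha> then b \<alpha> else 0) has_sum torus_coeff \<rho> f \<alpha>) UNIV" by simp
  moreover have "((\<lambda>\<beta>. if \<beta> = \<alpha> then b \<alpha> else 0) has_sum b \<alpha>) UNIV"
    by (subst has_sum_cong_neutral[where T = "{\<alpha>}" and g = "\<lambda>_. b \<alpha>"])
      (auto intro: has_sum_finiteI)
  ultimately show "torus_coeff \<rho> f \<alpha> = b \<alpha>" by (rule has_sum_unique)
qed

text \<open>The expansion with the coefficients of the larger radius is valid on the smaller torus, where
  coefficients are unique.\<close>

lemma torus_coeff_radius_independent:
  assumes f: "holomorphic_on_polydisk f" and "0 < \<rho>" "\<rho> < 1" "0 < \<sigma>" "\<sigma> < 1"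
  shows "torus_coeff \<rho> f = torus_coeff \<sigma> f"
proof -
  have *: "torus_coeff \<rho> f = torus_coeff \<sigma> f" if "0 < \<rho>" "\<rho> < \<sigma>" "\<sigma> < 1" for \<rho> \<sigma>
    by (rule torus_coeff_eqI[OF f], use that in simp, use that in simp, rule has_sum_torus_coeff[OF f])
      (use that in \<open>auto simp: torus_point_def norm_mult\<close>)
  consider "\<rho> < \<sigma>" | "\<rho> = \<sigma>" | "\<sigma> < \<rho>" by linarith
  then show ?thesis
  proof cases
    case 1
    then show ?thesis using assms by (intro *)
  next
    case 2
    then show ?thesis by simp
  next
    case 3
    then show ?thesis using assms by (intro *[symmetric])
  qed
qed

lemma has_sum_torus_coeff_polydisk:
  fixes z :: "complex ^ 'd::finite"
  assumes f: "holomorphic_on_polydisk f" and \<rho>: "0 < \<rho>" "\<rho> < 1" and z: "z \<in> polydisk"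
  shows "((\<lambda>\<alpha>. torus_coeff \<rho> f \<alpha> * mpower z \<alpha>) has_sum f z) UNIV"
proof -
  define m where "m = Max (range (\<lambda>i. norm (z $ i)))"
  have m: "norm (z $ i) \<le> m" for i by (simp add: m_def)
  have "m < 1" using z by (auto simp: m_def polydisk_def)
  moreover have "0 \<le> m" using m norm_ge_zero order_trans by blast
  ultimately obtain \<sigma> where \<sigma>: "m < \<sigma>" "\<sigma> < 1" "0 < \<sigma>" using dense[of m 1] by auto
  show ?thesis
    unfolding torus_coeff_radius_independent[OF f \<rho> \<sigma>(3,2)]
    by (rule has_sum_torus_coeff[OF f \<sigma>(3,2)]) (use m \<sigma> in \<open>auto intro: le_less_trans\<close>)
qed

lemma taylor_coeffs_eqI:
  assumes f: "holomorphic_on_polydisk f"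
    and a: "\<And>z. z \<in> polydisk \<Longrightarrow> ((\<lambda>\<alpha>. a \<alpha> * mpower z \<alpha>) has_sum f z) UNIV"
  shows "taylor_coeffs f = a"
  unfolding taylor_coeffs_def
proof (rule the_equality)
  have *: "torus_coeff (1/2) f = b" if "\<forall>z\<in>polydisk. ((\<lambda>\<alpha>. b \<alpha> * mpower z \<alpha>) has_sum f z) UNIV" for b
    by (rule torus_coeff_eqI[OF f]) (use that torus_point_in_polydisk[of "1/2"] in auto)
  show "b = a" if "\<forall>z\<in>polydisk. ((\<lambda>\<alpha>. b \<alpha> * mpower z \<alpha>) has_sum f z) UNIV" for b
    using *[OF that] *[of a] a by auto
qed (use a in auto)

lemma taylor_coeffs_eq_torus_coeff:
  assumes f: "holomorphic_on_polydisk f" and \<rho>: "0 < \<rho>" "\<rho> < 1"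
  shows "taylor_coeffs f = torus_coeff \<rho> f"
  by (rule taylor_coeffs_eqI[OF f]) (rule has_sum_torus_coeff_polydisk[OF f \<rho>])

lemma has_sum_taylor_coeffs:
  assumes "holomorphic_on_polydisk f" "z \<in> polydisk"
  shows "((\<lambda>\<alpha>. taylor_coeffs f \<alpha> * mpower z \<alpha>) has_sum f z) UNIV"
  using has_sum_torus_coeff_polydisk[OF assms(1), of "1/2"] assms(2)
    taylor_coeffs_eq_torus_coeff[OF assms(1), of "1/2"] by simp

text \<open>Cauchy's estimate.\<close>

lemma norm_taylor_coeffs_le:
  assumes f: "holomorphic_on_polydisk f" and \<rho>: "0 < \<rho>" "\<rho> < 1"
    and C: "\<And>\<theta>. norm (f (torus_point \<rho> \<theta>)) \<le> C"
  shows "norm (taylor_coeffs f \<alpha>) \<le> C / \<rho> ^ sum \<alpha> UNIV"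
  unfolding taylor_coeffs_eq_torus_coeff[OF f \<rho>] torus_coeff_def
  by (rule norm_torus_integral_le)
    (use C \<rho> in \<open>auto simp: norm_divide norm_mpower_torus_point intro!: divide_right_mono\<close>)

section \<open>Taylor coefficients of Hardy functions\<close>

lemma holomorphic_on_polydisk_add:
  assumes "holomorphic_on_polydisk f" "holomorphic_on_polydisk g"
  shows "holomorphic_on_polydisk (\<lambda>z. f z + g z)"
  unfolding holomorphic_on_polydisk_def
proof
  fix z :: "complex ^ 'a" assume z: "z \<in> polydisk"
  obtain f' g' where "(f has_derivative f') (at z)" "(g has_derivative g') (at z)"
    "Vector_Spaces.linear (*s) (*) f'" "Vector_Spaces.linear (*s) (*) g'"
    using assms z unfolding holomorphic_on_polydisk_def by metis
  then show "\<exists>h. ((\<lambda>z. f z + g z) has_derivative h) (at z) \<and> Vector_Spaces.linear (*s) (*) h"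
    by (intro exI[of _ "\<lambda>h. f' h + g' h"] conjI has_derivative_add)
      (auto simp: Vector_Spaces.linear_iff algebra_simps)
qed

lemma holomorphic_on_polydisk_cmult:
  assumes "holomorphic_on_polydisk f"
  shows "holomorphic_on_polydisk (\<lambda>z. c * f z)"
  unfolding holomorphic_on_polydisk_def
proof
  fix z :: "complex ^ 'a" assume z: "z \<in> polydisk"
  obtain f' where "(f has_derivative f') (at z)" "Vector_Spaces.linear (*s) (*) f'"
    using assms z unfolding holomorphic_on_polydisk_def by metis
  then show "\<exists>h. ((\<lambda>z. c * f z) has_derivative h) (at z) \<and> Vector_Spaces.linear (*s) (*) h"
    by (intro exI[of _ "\<lambda>h. c * f' h"] conjI has_derivative_mult_right)
      (auto simp: Vector_Spaces.linear_iff algebra_simps)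
qed

lemma taylor_coeffs_add:
  assumes "holomorphic_on_polydisk f" "holomorphic_on_polydisk g"
  shows "taylor_coeffs (\<lambda>z. f z + g z) = (\<lambda>\<alpha>. taylor_coeffs f \<alpha> + taylor_coeffs g \<alpha>)"
  using assms
  by (intro taylor_coeffs_eqI holomorphic_on_polydisk_add)
    (auto simp: distrib_right intro!: has_sum_add has_sum_taylor_coeffs)

lemma taylor_coeffs_cmult:
  assumes "holomorphic_on_polydisk f"
  shows "taylor_coeffs (\<lambda>z. c * f z) = (\<lambda>\<alpha>. c * taylor_coeffs f \<alpha>)"
  using assms
  by (intro taylor_coeffs_eqI holomorphic_on_polydisk_cmult)
    (auto simp: mult.assoc intro!: has_sum_cmult_right has_sum_taylor_coeffs)

lemma hardy2_holomorphic: "f \<in> hardy2 \<Longrightarrow> holomorphic_on_polydisk f"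
  by (simp add: hardy2_def)

text \<open>Square summability of a sum follows from \<open>\<bar>a + b\<bar>\<^sup>2 \<le> 2\<bar>a\<bar>\<^sup>2 + 2\<bar>b\<bar>\<^sup>2\<close>.\<close>

lemma subspace_hardy2: "fun_space.subspace (hardy2 :: (complex ^ 'd::finite \<Rightarrow> complex) set)"
proof (rule fun_space.subspaceI)
  have h0: "holomorphic_on_polydisk (0 :: complex ^ 'd \<Rightarrow> complex)"
    unfolding holomorphic_on_polydisk_def
    by (auto intro!: exI[of _ "\<lambda>_. 0"] simp: Vector_Spaces.linear_iff zero_fun_def vec.vector_space_axioms
        vector_space_over_itself.vector_space_axioms)
  have "taylor_coeffs (0 :: complex ^ 'd \<Rightarrow> complex) = (\<lambda>_. 0)"
    using h0 by (intro taylor_coeffs_eqI) auto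
  then show "0 \<in> (hardy2 :: (complex ^ 'd \<Rightarrow> complex) set)"
    using h0 by (simp add: hardy2_def)
next
  fix f g :: "complex ^ 'd \<Rightarrow> complex" assume f: "f \<in> hardy2" and g: "g \<in> hardy2"
  let ?a = "taylor_coeffs f" and ?b = "taylor_coeffs g"
  have "(\<lambda>\<alpha>. (norm (?a \<alpha> + ?b \<alpha>))\<^sup>2) summable_on UNIV"
  proof (rule summable_on_comparison_test)
    show "(\<lambda>\<alpha>. 2 * (norm (?a \<alpha>))\<^sup>2 + 2 * (norm (?b \<alpha>))\<^sup>2) summable_on UNIV"
      using f g by (intro summable_on_add summable_on_cmult_right) (auto simp: hardy2_def)
    show "(norm (?a \<alpha> + ?b \<alpha>))\<^sup>2 \<le> 2 * (norm (?a \<alpha>))\<^sup>2 + 2 * (norm (?b \<alpha>))\<^sup>2" for \<alpha>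
    proof -
      have "(norm (?a \<alpha> + ?b \<alpha>))\<^sup>2 \<le> (norm (?a \<alpha>) + norm (?b \<alpha>))\<^sup>2"
        by (intro power_mono norm_triangle_ineq) auto
      also have "\<dots> \<le> 2 * (norm (?a \<alpha>))\<^sup>2 + 2 * (norm (?b \<alpha>))\<^sup>2"
        using zero_le_power2[of "norm (?a \<alpha>) - norm (?b \<alpha>)"] by (simp add: power2_eq_square algebra_simps)
      finally show ?thesis .
    qed
  qed auto
  then show "f + g \<in> hardy2"
    using f g taylor_coeffs_add[of f g] holomorphic_on_polydisk_add[of f g]
    by (auto simp: hardy2_def plus_fun_def)
next
  fix c :: complex and f :: "complex ^ 'd \<Rightarrow> complex" assume f: "f \<in> hardy2"
  have "(\<lambda>\<alpha>. (norm c)\<^sup>2 * (norm (taylor_coeffs f \<alpha>))\<^sup>2) summable_on UNIV"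
    using f by (intro summable_on_cmult_right) (auto simp: hardy2_def)
  then show "(\<lambda>z. c * f z) \<in> hardy2"
    using f by (auto simp: hardy2_def taylor_coeffs_cmult holomorphic_on_polydisk_cmult
        norm_mult power_mult_distrib)
qed

lemma taylor_coeffs_diff:
  assumes "f \<in> hardy2" "g \<in> hardy2"
  shows "taylor_coeffs (f - g) \<alpha> = taylor_coeffs f \<alpha> - taylor_coeffs g \<alpha>"
proof -
  have "f - g \<in> hardy2" by (rule fun_space.subspace_diff[OF subspace_hardy2 assms])
  then have "taylor_coeffs (\<lambda>z. (f - g) z + g z) \<alpha> = taylor_coeffs (f - g) \<alpha> + taylor_coeffs g \<alpha>"
    using assms by (simp add: taylor_coeffs_add hardy2_holomorphic del: minus_apply)
  moreover have "(\<lambda>z. (f - g) z + g z) = f" by (simp add: fun_eq_iff)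
  ultimately show ?thesis by simp
qed

lemma norm_taylor_coeffs_le_hardy2_norm:
  assumes "f \<in> hardy2"
  shows "norm (taylor_coeffs f \<alpha>) \<le> hardy2_norm f"
proof -
  have "(\<Sum>\<beta>\<in>{\<alpha>}. (norm (taylor_coeffs f \<beta>))\<^sup>2) \<le> (\<Sum>\<^sub>\<infinity>\<beta>. (norm (taylor_coeffs f \<beta>))\<^sup>2)"
    using assms by (intro finite_sum_le_infsum) (auto simp: hardy2_def)
  then show ?thesis unfolding hardy2_norm_def by (intro real_le_rsqrt) simp
qed

section \<open>Functions vanishing at the origin\<close>

definition vanishes_to_order :: "nat \<Rightarrow> (complex ^ 'd::finite \<Rightarrow> complex) \<Rightarrow> bool" where
  "vanishes_to_order k f \<longleftrightarrow> (\<exists>C. \<forall>\<^sub>F z in nhds 0. norm (f z) \<le> C * norm z ^ k)"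

lemma vanishes_to_order_mult:
  assumes "vanishes_to_order k f" "vanishes_to_order l g"
  shows "vanishes_to_order (k + l) (\<lambda>z. f z * g z)"
proof -
  obtain C D where CD: "\<forall>\<^sub>F z in nhds 0. norm (f z) \<le> C * norm z ^ k" "\<forall>\<^sub>F z in nhds 0. norm (g z) \<le> D * norm z ^ l"
    using assms unfolding vanishes_to_order_def by blast
  then have "\<forall>\<^sub>F z in nhds 0. norm (f z * g z) \<le> (C * D) * norm z ^ (k + l)"
  proof eventually_elim
    case (elim z)
    then have "norm (f z) * norm (g z) \<le> (C * norm z ^ k) * (D * norm z ^ l)"
      by (intro mult_mono) (auto intro: order_trans[OF norm_ge_zero])
    then show ?case by (simp add: norm_mult power_add mult_ac)
  qed
  then show ?thesis unfolding vanishes_to_order_def by blast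
qed

lemma vanishes_to_order_power:
  "vanishes_to_order 1 f \<Longrightarrow> vanishes_to_order n (\<lambda>z. f z ^ n)"
proof (induction n)
  case 0
  then show ?case by (auto simp: vanishes_to_order_def intro!: exI[of _ 1])
next
  case (Suc n)
  then show ?case using vanishes_to_order_mult[of 1 f n "\<lambda>z. f z ^ n"] by simp
qed

lemma vanishes_to_order_tuple_power:
  assumes "\<And>l. vanishes_to_order 1 (\<Psi> l)"
  shows "vanishes_to_order (sum \<beta> UNIV) (tuple_power \<Psi> \<beta>)"
proof -
  have "vanishes_to_order (sum \<beta> A) (\<lambda>z. \<Prod>l\<in>A. \<Psi> l z ^ \<beta> l)" if "finite A" for A
    using that
  proof (induction A rule: finite_induct)
    case empty
    then show ?case by (auto simp: vanishes_to_order_def intro!: exI[of _ 1])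
  next
    case (insert l A)
    then show ?case
      using vanishes_to_order_mult[OF vanishes_to_order_power[OF assms[of l], of "\<beta> l"]] by simp
  qed
  then show ?thesis by (simp add: tuple_power_def[abs_def])
qed

lemma zero_in_polydisk: "0 \<in> polydisk"
  by (simp add: polydisk_def)

text \<open>Differentiability at the origin gives a linear bound.\<close>

lemma vanishes_to_order_1_diff_value:
  assumes "holomorphic_on_polydisk f"
  shows "vanishes_to_order 1 (\<lambda>z. f z - f 0)"
proof -
  obtain f' where "(f has_derivative f') (at 0)"
    using assms zero_in_polydisk unfolding holomorphic_on_polydisk_def by blast
  then have bl: "bounded_linear f'" and "\<exists>d>0. \<forall>y. norm (y - 0) < d \<longrightarrow> norm (f y - f 0 - f' (y - 0)) \<le> 1 * norm (y - 0)"
    unfolding has_derivative_at_alt using zero_less_one by blast+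
  then obtain d where d: "d > 0" "\<And>y. norm y < d \<Longrightarrow> norm (f y - f 0 - f' y) \<le> norm y" by auto
  obtain K where K: "\<And>y. norm (f' y) \<le> norm y * K" using bounded_linear.bounded[OF bl] by blast
  have "norm (f y - f 0) \<le> (1 + K) * norm y ^ 1" if "dist y 0 < d" for y
    using norm_triangle_sub[of "f y - f 0" "f' y"] d(2)[of y] K[of y] that by (simp add: algebra_simps)
  then show ?thesis unfolding vanishes_to_order_def eventually_nhds_metric using d(1) by blast
qed

lemma vanishes_to_order_0:
  assumes "holomorphic_on_polydisk f"
  shows "vanishes_to_order 0 f"
proof -
  have "isCont f 0"
    using assms zero_in_polydisk unfolding holomorphic_on_polydisk_def by (blast dest: has_derivative_continuous)
  then have "((\<lambda>z. norm (f z)) \<longlongrightarrow> norm (f 0)) (nhds 0)"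
    by (intro tendsto_norm) (rule isCont_tendsto_compose[OF _ filterlim_ident])
  then have "\<forall>\<^sub>F z in nhds 0. norm (f z) < norm (f 0) + 1"
    by (rule order_tendstoD) simp
  then have "\<forall>\<^sub>F z in nhds 0. norm (f z) \<le> (norm (f 0) + 1) * norm z ^ 0"
    by eventually_elim simp
  then show ?thesis unfolding vanishes_to_order_def by blast
qed

text \<open>On the torus of radius \<open>\<rho>\<close> the function is \<open>O(\<rho>\<^sup>k)\<close>, so Cauchy's estimate bounds the coefficient by
  a constant times \<open>\<rho>\<^bsup>k - \<bar>\<alpha>\<bar>\<^esup>\<close>, which tends to zero with \<open>\<rho>\<close>.\<close>

lemma taylor_coeffs_eq_0_of_vanishing:
  fixes f :: "complex ^ 'd::finite \<Rightarrow> complex"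
  assumes f: "holomorphic_on_polydisk f" and v: "vanishes_to_order k f" and \<alpha>: "sum \<alpha> UNIV < k"
  shows "taylor_coeffs f \<alpha> = 0"
proof -
  obtain C d where d: "d > 0" and C: "\<And>z. norm z < d \<Longrightarrow> norm (f z) \<le> C * norm z ^ k"
    using v unfolding vanishes_to_order_def eventually_nhds_metric by auto
  let ?D = "real CARD('d)"
  have D: "?D > 0" by simp
  \<comment> \<open>The torus of radius \<open>\<rho>\<close> lies in the Euclidean ball of radius \<open>?D * \<rho>\<close>,
      which has to be below \<open>d\<close>.\<close>
  have le: "norm (taylor_coeffs f \<alpha>) \<le> \<bar>C\<bar> * ?D ^ k * \<rho>" if \<rho>: "0 < \<rho>" "\<rho> < min 1 (d / ?D)" for \<rho>
  proof -
    have "norm (f (torus_point \<rho> \<theta>)) \<le> \<bar>C\<bar> * (?D * \<rho>) ^ k" for \<theta>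
    proof -
      have n: "norm (torus_point \<rho> \<theta> :: complex ^ 'd) \<le> ?D * \<rho>"
        unfolding norm_vec_def using L2_set_le_sum[of UNIV "\<lambda>i. norm ((torus_point \<rho> \<theta> :: complex ^ 'd) $ i)"] \<rho>
        by (simp add: torus_point_def norm_mult)
      moreover have "?D * \<rho> < d" using \<rho> D by (simp add: field_simps)
      ultimately have "norm (f (torus_point \<rho> \<theta>)) \<le> C * norm (torus_point \<rho> \<theta> :: complex ^ 'd) ^ k"
        by (intro C) simp
      also have "\<dots> \<le> \<bar>C\<bar> * (?D * \<rho>) ^ k"
        using n by (intro mult_mono power_mono) auto
      finally show ?thesis .
    qed
    then have "norm (taylor_coeffs f \<alpha>) \<le> \<bar>C\<bar> * (?D * \<rho>) ^ k / \<rho> ^ sum \<alpha> UNIV"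
      using \<rho> by (intro norm_taylor_coeffs_le[OF f]) auto
    also have "\<dots> = \<bar>C\<bar> * ?D ^ k * \<rho> ^ (k - sum \<alpha> UNIV)"
      using \<rho> \<alpha> by (simp add: power_mult_distrib power_diff)
    also have "\<dots> \<le> \<bar>C\<bar> * ?D ^ k * \<rho> ^ 1"
      using \<rho> \<alpha> by (intro mult_left_mono power_decreasing) auto
    finally show ?thesis by simp
  qed
  have "\<forall>\<^sub>F \<rho> in at_right 0. norm (taylor_coeffs f \<alpha>) \<le> \<bar>C\<bar> * ?D ^ k * \<rho>"
    unfolding eventually_at_right_field using le d D by (intro exI[of _ "min 1 (d / ?D)"]) auto
  moreover have "((\<lambda>\<rho>. \<bar>C\<bar> * ?D ^ k * \<rho>) \<longlongrightarrow> \<bar>C\<bar> * ?D ^ k * 0) (at_right 0)"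
    by (intro tendsto_intros)
  ultimately have "norm (taylor_coeffs f \<alpha>) \<le> \<bar>C\<bar> * ?D ^ k * 0"
    by (intro tendsto_lowerbound) auto
  then show ?thesis by simp
qed

section \<open>Shifting the symbols by constants\<close>

lemma sum_fun_apply: "(\<Sum>a\<in>A. h a) z = (\<Sum>a\<in>A. h a z)"
  by (induction A rule: infinite_finite_induct) auto

text \<open>The binomial theorem in every factor, multiplied out.\<close>

lemma tuple_power_shift_in_span:
  fixes \<Phi> :: "'q::finite \<Rightarrow> complex ^ 'd::finite \<Rightarrow> complex"
  shows "tuple_power (\<lambda>l z. \<Phi> l z + c l) \<beta> * f \<in> fun_space.span {tuple_power \<Phi> \<alpha> * f | \<alpha>. True}"
proof -
  define S where "S = PiE UNIV (\<lambda>l. {..\<beta> l})"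
  define w where "w = (\<lambda>\<alpha>. \<Prod>l\<in>UNIV. of_nat (\<beta> l choose \<alpha> l) * c l ^ (\<beta> l - \<alpha> l))"
  have "tuple_power (\<lambda>l z. \<Phi> l z + c l) \<beta> z = (\<Sum>\<alpha>\<in>S. w \<alpha> * tuple_power \<Phi> \<alpha> z)" for z
  proof -
    have "tuple_power (\<lambda>l z. \<Phi> l z + c l) \<beta> z
        = (\<Prod>l\<in>UNIV. \<Sum>k\<le>\<beta> l. of_nat (\<beta> l choose k) * \<Phi> l z ^ k * c l ^ (\<beta> l - k))"
      by (simp add: tuple_power_def binomial_ring)
    also have "\<dots> = (\<Sum>\<alpha>\<in>S. \<Prod>l\<in>UNIV. of_nat (\<beta> l choose \<alpha> l) * \<Phi> l z ^ \<alpha> l * c l ^ (\<beta> l - \<alpha> l))"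
      unfolding S_def by (rule prod_sum_PiE) auto
    also have "\<dots> = (\<Sum>\<alpha>\<in>S. w \<alpha> * tuple_power \<Phi> \<alpha> z)"
      by (simp add: w_def tuple_power_def prod.distrib mult_ac)
    finally show ?thesis .
  qed
  then have "tuple_power (\<lambda>l z. \<Phi> l z + c l) \<beta> * f = (\<Sum>\<alpha>\<in>S. (\<lambda>z. w \<alpha> * (tuple_power \<Phi> \<alpha> * f) z))"
    by (simp add: fun_eq_iff sum_fun_apply sum_distrib_left mult_ac)
  also have "\<dots> \<in> fun_space.span {tuple_power \<Phi> \<alpha> * f | \<alpha>. True}"
    by (intro fun_space.span_sum fun_space.span_scale fun_space.span_base) blast
  finally show ?thesis .
qed

section \<open>Coefficient families with finite support\<close>

interpretation coeff_space: vector_space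
  "\<lambda>(c::complex) (v :: ('d::finite \<Rightarrow> nat) \<Rightarrow> complex) \<alpha>. c * v \<alpha>"
  by standard (auto simp: fun_eq_iff algebra_simps)

interpretation coeff_functional: vector_space_pair
  "\<lambda>(c::complex) (v :: ('d::finite \<Rightarrow> nat) \<Rightarrow> complex) \<alpha>. c * v \<alpha>" "(*) :: complex \<Rightarrow> complex \<Rightarrow> complex"
  by standard

text \<open>Extend a basis of the span by \<open>x\<close> and take the linear functional that is \<open>1\<close> at \<open>x\<close> and \<open>0\<close> on the
  basis. On families supported in the finite set \<open>B\<close> it is a finite sum over the coordinates, hence
  continuous for the convergence of each coordinate.\<close>

lemma coeff_space_separating_functional:
  fixes S :: "(('d::finite \<Rightarrow> nat) \<Rightarrow> complex) set"
  assumes B: "finite B" and S: "\<And>v \<alpha>. v \<in> S \<Longrightarrow> \<alpha> \<notin> B \<Longrightarrow> v \<alpha> = 0"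
    and x: "\<And>\<alpha>. \<alpha> \<notin> B \<Longrightarrow> x \<alpha> = 0" "x \<notin> coeff_space.span S"
  shows "\<exists>c. (\<forall>v\<in>coeff_space.span S. (\<Sum>\<alpha>\<in>B. c \<alpha> * v \<alpha>) = 0) \<and> (\<Sum>\<alpha>\<in>B. c \<alpha> * x \<alpha>) = 1"
proof -
  obtain T where T: "T \<subseteq> S" "coeff_space.independent T" "S \<subseteq> coeff_space.span T"
    using coeff_space.maximal_independent_subset by blast
  have span: "coeff_space.span T = coeff_space.span S"
    using T by (simp add: coeff_space.span_eq subset_trans[OF T(1) coeff_space.span_superset])
  then have "x \<notin> coeff_space.span T" using x by simp
  then have ind: "coeff_space.independent (insert x T)"
    using T(2) by (simp add: coeff_space.independent_insert)
  define h where "h = (\<lambda>v :: ('d \<Rightarrow> nat) \<Rightarrow> complex. if v = x then 1 else 0 :: complex)"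
  obtain g where g: "Vector_Spaces.linear (\<lambda>c v \<alpha>. c * v \<alpha>) (*) g" "\<forall>v\<in>insert x T. g v = h v"
    using coeff_functional.linear_independent_extend[OF ind, of h] by blast
  interpret g: Vector_Spaces.linear "\<lambda>c v \<alpha>. c * v \<alpha>" "(*)" g by fact
  define e where "e = (\<lambda>\<alpha> :: 'd \<Rightarrow> nat. (\<lambda>\<beta>. if \<beta> = \<alpha> then 1 else 0 :: complex))"
  have expand: "g v = (\<Sum>\<alpha>\<in>B. g (e \<alpha>) * v \<alpha>)" if "\<And>\<alpha>. \<alpha> \<notin> B \<Longrightarrow> v \<alpha> = 0" for v
  proof -
    have "v = (\<Sum>\<alpha>\<in>B. (\<lambda>\<beta>. v \<alpha> * e \<alpha> \<beta>))"
      by (rule ext) (use B that in \<open>auto simp: sum_fun_apply e_def if_distrib cong: if_cong\<close>)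
    then have "g v = g (\<Sum>\<alpha>\<in>B. (\<lambda>\<beta>. v \<alpha> * e \<alpha> \<beta>))" by (rule arg_cong)
    also have "\<dots> = (\<Sum>\<alpha>\<in>B. v \<alpha> * g (e \<alpha>))" by (simp only: g.sum g.scale)
    finally show ?thesis by (simp only: mult.commute)
  qed
  have T0: "g v = 0" if "v \<in> T" for v
    using g(2) that \<open>x \<notin> coeff_space.span T\<close> coeff_space.span_base[of v T] by (auto simp: h_def)
  have supp: "v \<alpha> = 0" if "v \<in> coeff_space.span S" "\<alpha> \<notin> B" for v \<alpha>
  proof -
    have "coeff_space.span S \<subseteq> {v. v \<alpha> = 0}"
      using S that(2) by (intro coeff_space.span_minimal coeff_space.subspaceI) auto
    then show ?thesis using that(1) by auto
  qed
  have "coeff_space.span T \<subseteq> {v. g v = 0}"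
    using T0 by (intro coeff_space.span_minimal coeff_space.subspaceI) (auto simp: g.add g.scale g.zero)
  then have "(\<Sum>\<alpha>\<in>B. g (e \<alpha>) * v \<alpha>) = 0" if "v \<in> coeff_space.span S" for v
    using that expand[of v] supp[OF that] unfolding span by auto
  moreover have "(\<Sum>\<alpha>\<in>B. g (e \<alpha>) * x \<alpha>) = 1"
    using expand[of x] x(1) g(2) by (simp add: h_def)
  ultimately show ?thesis by (intro exI[of _ "\<lambda>\<alpha>. g (e \<alpha>)"] conjI ballI)
qed

text \<open>A separating functional would be small at \<open>x\<close>, because \<open>x\<close> is approximated by vectors on which
  the functional vanishes.\<close>

lemma coeff_space_span_closed:
  fixes S :: "(('d::finite \<Rightarrow> nat) \<Rightarrow> complex) set"
  assumes B: "finite B" and S: "\<And>v \<alpha>. v \<in> S \<Longrightarrow> \<alpha> \<notin> B \<Longrightarrow> v \<alpha> = 0"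
    and x: "\<And>\<alpha>. \<alpha> \<notin> B \<Longrightarrow> x \<alpha> = 0"
    and approx: "\<And>e. e > 0 \<Longrightarrow> \<exists>v\<in>coeff_space.span S. \<forall>\<alpha>\<in>B. norm (x \<alpha> - v \<alpha>) < e"
  shows "x \<in> coeff_space.span S"
proof (rule ccontr)
  assume "x \<notin> coeff_space.span S"
  with B S x have "\<exists>c. (\<forall>v\<in>coeff_space.span S. (\<Sum>\<alpha>\<in>B. c \<alpha> * v \<alpha>) = 0) \<and> (\<Sum>\<alpha>\<in>B. c \<alpha> * x \<alpha>) = 1"
    by (rule coeff_space_separating_functional)
  then obtain c where c: "\<And>v. v \<in> coeff_space.span S \<Longrightarrow> (\<Sum>\<alpha>\<in>B. c \<alpha> * v \<alpha>) = 0"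
    "(\<Sum>\<alpha>\<in>B. c \<alpha> * x \<alpha>) = 1"
    by blast
  \<comment> \<open>An error below \<open>1 / (s + 1)\<close> in each coordinate changes the functional
      by less than \<open>1\<close>, its value at \<open>x\<close>; adding \<open>1\<close> covers the case \<open>s = 0\<close>.\<close>
  define s where "s = (\<Sum>\<alpha>\<in>B. norm (c \<alpha>))"
  have s: "s \<ge> 0" unfolding s_def by (intro sum_nonneg) auto
  obtain v where v: "v \<in> coeff_space.span S" "\<forall>\<alpha>\<in>B. norm (x \<alpha> - v \<alpha>) < 1 / (s + 1)"
    using approx[of "1 / (s + 1)"] s by auto
  have "1 = norm (\<Sum>\<alpha>\<in>B. c \<alpha> * (x \<alpha> - v \<alpha>))"
    using c v(1) by (simp add: right_diff_distrib sum_subtractf)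
  also have "\<dots> \<le> (\<Sum>\<alpha>\<in>B. norm (c \<alpha>) * (1 / (s + 1)))"
    using v(2)
    by (intro sum_norm_le) (simp only: norm_mult, intro mult_left_mono[OF less_imp_le], auto)
  also have "\<dots> = s * (1 / (s + 1))"  unfolding s_def by (rule sum_distrib_right[symmetric])
  also have "\<dots> < 1" using s by simp
  finally show False by simp
qed

section \<open>Truncation of Taylor coefficients\<close>

definition index_box :: "('d::finite \<Rightarrow> nat) \<Rightarrow> ('d \<Rightarrow> nat) set" where
  "index_box N = {\<alpha>. \<forall>l. \<alpha> l < N l}"

lemma index_box_eq_PiE: "index_box N = PiE UNIV (\<lambda>l. {..<N l})"
  by (auto simp: index_box_def PiE_def Pi_def)

lemma finite_index_box: "finite (index_box N)"
  unfolding index_box_eq_PiE by (intro finite_PiE) auto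

lemma card_index_box: "card (index_box N) = (\<Prod>l\<in>UNIV. N l)"
  unfolding index_box_eq_PiE by (simp add: card_PiE)

text \<open>The truncation with values in coefficient families instead of the quotient algebra. Here span and
  closure can be treated with ordinary linear algebra over \<open>\<complex>\<close>.\<close>

definition trunc_coeffs :: "('d::finite \<Rightarrow> nat) \<Rightarrow> (complex ^ 'd \<Rightarrow> complex) \<Rightarrow> ('d \<Rightarrow> nat) \<Rightarrow> complex" where
  "trunc_coeffs N f = (\<lambda>\<alpha>. if \<alpha> \<in> index_box N then taylor_coeffs f \<alpha> else 0)"

lemma trunc_coeffs_add:
  assumes "f \<in> hardy2" "g \<in> hardy2"
  shows "trunc_coeffs N (f + g) = trunc_coeffs N f + trunc_coeffs N g"
  using taylor_coeffs_add[OF assms[THEN hardy2_holomorphic]]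
  by (auto simp: trunc_coeffs_def fun_eq_iff plus_fun_def)

lemma trunc_coeffs_cmult:
  assumes "f \<in> hardy2"
  shows "trunc_coeffs N (\<lambda>z. c * f z) = (\<lambda>\<alpha>. c * trunc_coeffs N f \<alpha>)"
  using taylor_coeffs_cmult[OF assms[THEN hardy2_holomorphic], of c]
  by (auto simp: trunc_coeffs_def fun_eq_iff)

lemma trunc_coeffs_0: "trunc_coeffs N 0 = 0"
  using trunc_coeffs_add[of 0 0 N] fun_space.subspace_0[OF subspace_hardy2] by simp

lemma trunc_coeffs_span:
  assumes "G \<subseteq> hardy2"
  shows "trunc_coeffs N ` fun_space.span G = coeff_space.span (trunc_coeffs N ` G)"
proof
  have "fun_space.subspace {f \<in> hardy2. trunc_coeffs N f \<in> coeff_space.span (trunc_coeffs N ` G)}"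
    (is "fun_space.subspace ?V")
  proof (rule fun_space.subspaceI)
    show "0 \<in> ?V"
      using fun_space.subspace_0[OF subspace_hardy2] by (simp add: trunc_coeffs_0 coeff_space.span_zero)
    show "f + g \<in> ?V" if "f \<in> ?V" "g \<in> ?V" for f g
      using that by (simp add: trunc_coeffs_add coeff_space.span_add fun_space.subspace_add[OF subspace_hardy2])
    show "(\<lambda>z. c * f z) \<in> ?V" if "f \<in> ?V" for c f
      using that
      by (simp add: trunc_coeffs_cmult coeff_space.span_scale fun_space.subspace_scale[OF subspace_hardy2])
  qed
  then have "fun_space.span G \<subseteq> {f \<in> hardy2. trunc_coeffs N f \<in> coeff_space.span (trunc_coeffs N ` G)}"
    using assms by (intro fun_space.span_minimal) (auto intro: coeff_space.span_base)
  then show "trunc_coeffs N ` fun_space.span G \<subseteq> coeff_space.span (trunc_coeffs N ` G)" by auto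
next
  have sub: "fun_space.span G \<subseteq> hardy2"
    by (rule fun_space.span_minimal[OF assms subspace_hardy2])
  show "coeff_space.span (trunc_coeffs N ` G) \<subseteq> trunc_coeffs N ` fun_space.span G"
  proof (intro coeff_space.span_minimal coeff_space.subspaceI)
    show "trunc_coeffs N ` G \<subseteq> trunc_coeffs N ` fun_space.span G"
      using fun_space.span_superset by blast
    show "0 \<in> trunc_coeffs N ` fun_space.span G"
      using trunc_coeffs_0 fun_space.span_zero by (metis imageI)
    show "v + w \<in> trunc_coeffs N ` fun_space.span G"
      if vw: "v \<in> trunc_coeffs N ` fun_space.span G" "w \<in> trunc_coeffs N ` fun_space.span G" for v w
    proof -
      obtain f g where fg: "v = trunc_coeffs N f" "w = trunc_coeffs N g" "f \<in> fun_space.span G" "g \<in> fun_space.span G"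
        using vw by blast
      then have "v + w = trunc_coeffs N (f + g)" using sub by (simp add: trunc_coeffs_add subset_iff)
      then show ?thesis using fg fun_space.span_add by blast
    qed
    show "(\<lambda>\<alpha>. c * v \<alpha>) \<in> trunc_coeffs N ` fun_space.span G"
      if v: "v \<in> trunc_coeffs N ` fun_space.span G" for c v
    proof -
      obtain f where f: "v = trunc_coeffs N f" "f \<in> fun_space.span G" using v by blast
      then have "(\<lambda>\<alpha>. c * v \<alpha>) = trunc_coeffs N (\<lambda>z. c * f z)"
        using sub by (simp add: trunc_coeffs_cmult subset_iff)
      then show ?thesis using f(2) fun_space.span_scale[of f G c] by blast
    qed
  qed
qed

lemma span_subset_hardy2_closure:
  assumes "G \<subseteq> hardy2"
  shows "fun_space.span G \<subseteq> hardy2_closure (fun_space.span G)"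
proof
  fix g assume g: "g \<in> fun_space.span G"
  then have "g \<in> hardy2" using fun_space.span_minimal[OF assms subspace_hardy2] by blast
  then have "hardy2_norm (g - g) = 0"
    using taylor_coeffs_diff[of g g] by (simp add: hardy2_norm_def del: diff_self)
  then show "g \<in> hardy2_closure (fun_space.span G)"
    using g \<open>g \<in> hardy2\<close> unfolding hardy2_closure_def by (auto intro!: bexI[of _ g])
qed

text \<open>Each Taylor coefficient is bounded by the Hardy norm, so the truncation of a function in the
  closure is a limit of truncations from the span, and these form a closed set.\<close>

lemma trunc_coeffs_hardy2_closure_span:
  assumes G: "G \<subseteq> hardy2"
  shows "trunc_coeffs N ` hardy2_closure (fun_space.span G) = coeff_space.span (trunc_coeffs N ` G)"
proof
  show "coeff_space.span (trunc_coeffs N ` G) \<subseteq> trunc_coeffs N ` hardy2_closure (fun_space.span G)"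
    using span_subset_hardy2_closure[OF G] trunc_coeffs_span[OF G, of N] by blast
  show "trunc_coeffs N ` hardy2_closure (fun_space.span G) \<subseteq> coeff_space.span (trunc_coeffs N ` G)"
  proof (intro image_subsetI coeff_space_span_closed[OF finite_index_box])
    fix f and e :: real assume f: "f \<in> hardy2_closure (fun_space.span G)" and e: "e > 0"
    then obtain g where g: "g \<in> fun_space.span G" "hardy2_norm (f - g) < e" and fh: "f \<in> hardy2"
      unfolding hardy2_closure_def by blast
    have gh: "g \<in> hardy2" using g fun_space.span_minimal[OF G subspace_hardy2] by blast
    have "norm (trunc_coeffs N f \<alpha> - trunc_coeffs N g \<alpha>) < e" if "\<alpha> \<in> index_box N" for \<alpha>
      using norm_taylor_coeffs_le_hardy2_norm[OF fun_space.subspace_diff[OF subspace_hardy2 fh gh], of \<alpha>] g(2)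
      by (simp add: trunc_coeffs_def that taylor_coeffs_diff[OF fh gh])
    moreover have "trunc_coeffs N g \<in> coeff_space.span (trunc_coeffs N ` G)"
      using g(1) trunc_coeffs_span[OF G, of N] by blast
    ultimately show "\<exists>v\<in>coeff_space.span (trunc_coeffs N ` G). \<forall>\<alpha>\<in>index_box N. norm (trunc_coeffs N f \<alpha> - v \<alpha>) < e"
      by blast
  qed (auto simp: trunc_coeffs_def)
qed

lemma span_tuple_power_shift_subset:
  "fun_space.span {tuple_power (\<lambda>l z. \<Phi> l z + c l) \<beta> * F j | \<beta> j. True}
     \<subseteq> fun_space.span {tuple_power \<Phi> \<alpha> * F j | \<alpha> j. True}"
proof (intro fun_space.span_minimal fun_space.subspace_span subsetI)
  fix f assume "f \<in> {tuple_power (\<lambda>l z. \<Phi> l z + c l) \<beta> * F j | \<beta> j. True}"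
  then obtain \<beta> j where f: "f = tuple_power (\<lambda>l z. \<Phi> l z + c l) \<beta> * F j" by blast
  have "f \<in> fun_space.span {tuple_power \<Phi> \<alpha> * F j | \<alpha>. True}"
    unfolding f by (rule tuple_power_shift_in_span)
  also have "\<dots> \<subseteq> fun_space.span {tuple_power \<Phi> \<alpha> * F j | \<alpha> j. True}"
    by (rule fun_space.span_mono) blast
  finally show "f \<in> fun_space.span {tuple_power \<Phi> \<alpha> * F j | \<alpha> j. True}" .
qed

text \<open>The shift by \<open>c\<close> undoes the shift by \<open>- c\<close>, so the inclusion of spans holds both ways.\<close>

lemma span_tuple_power_shift:
  "fun_space.span {tuple_power (\<lambda>l z. \<Phi> l z - c l) \<beta> * F j | \<beta> j. True}
     = fun_space.span {tuple_power \<Phi> \<alpha> * F j | \<alpha> j. True}"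
proof (rule subset_antisym)
  show "fun_space.span {tuple_power (\<lambda>l z. \<Phi> l z - c l) \<beta> * F j | \<beta> j. True}
      \<subseteq> fun_space.span {tuple_power \<Phi> \<alpha> * F j | \<alpha> j. True}"
    using span_tuple_power_shift_subset[of \<Phi> "\<lambda>l. - c l" F] by (simp only: add_uminus_conv_diff)
  show "fun_space.span {tuple_power \<Phi> \<alpha> * F j | \<alpha> j. True}
      \<subseteq> fun_space.span {tuple_power (\<lambda>l z. \<Phi> l z - c l) \<beta> * F j | \<beta> j. True}"
    using span_tuple_power_shift_subset[of "\<lambda>l z. \<Phi> l z - c l" c F] by (simp only: diff_add_cancel)
qed

lemma trunc_coeffs_eq_0_of_vanishing:
  fixes N :: "'d::finite \<Rightarrow> nat"
  assumes f: "f \<in> hardy2" and v: "vanishes_to_order k f" and k: "(\<Sum>l\<in>UNIV. N l - 1) < k"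
  shows "trunc_coeffs N f = 0"
proof
  fix \<alpha> :: "'d \<Rightarrow> nat"
  have "sum \<alpha> UNIV < k" if "\<alpha> \<in> index_box N"
  proof -
    have "\<alpha> l \<le> N l - 1" for l using that by (auto simp: index_box_def dest: spec[of _ l])
    then have "sum \<alpha> UNIV \<le> (\<Sum>l\<in>UNIV. N l - 1)" by (intro sum_mono)
    then show ?thesis using k by simp
  qed
  then show "trunc_coeffs N f \<alpha> = 0 \<alpha>"
    using taylor_coeffs_eq_0_of_vanishing[OF hardy2_holomorphic[OF f] v] by (simp add: trunc_coeffs_def)
qed

text \<open>After the shift of the symbols to functions that vanish at the origin, all but finitely many
  of the generators are truncated to zero.\<close>

lemma trunc_coeffs_M_space:
  fixes \<Phi> :: "'q::finite \<Rightarrow> complex ^ 'd::finite \<Rightarrow> complex" and F :: "'r::finite \<Rightarrow> complex ^ 'd \<Rightarrow> complex"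
  assumes \<Phi>: "\<And>l. holomorphic_on_polydisk (\<Phi> l)" and F: "\<And>j. F j \<in> D_infinity \<Phi>"
  shows "trunc_coeffs N ` M_space \<Phi> F = coeff_space.span (trunc_coeffs N `
    {tuple_power (\<lambda>l z. \<Phi> l z - \<Phi> l 0) \<beta> * F j | \<beta> j. sum \<beta> UNIV < 1 + (\<Sum>l\<in>UNIV. N l - 1)})"
    (is "_ = coeff_space.span (_ ` ?G')")
proof -
  define \<Psi> where "\<Psi> = (\<lambda>l z. \<Phi> l z - \<Phi> l 0)"
  define G where "G = {tuple_power \<Phi> \<alpha> * F j | \<alpha> j. True}"
  define H where "H = {tuple_power \<Psi> \<beta> * F j | \<beta> j. True}"
  have G: "G \<subseteq> hardy2" using F by (auto simp: G_def D_infinity_def)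
  have span: "fun_space.span H = fun_space.span G"
    unfolding H_def G_def \<Psi>_def by (rule span_tuple_power_shift)
  then have H: "H \<subseteq> hardy2"
    using fun_space.span_superset[of H] fun_space.span_minimal[OF G subspace_hardy2] by blast
  have "trunc_coeffs N f \<in> insert 0 (trunc_coeffs N ` ?G')" if "f \<in> H" for f
  proof -
    obtain \<beta> j where f: "f = tuple_power \<Psi> \<beta> * F j" using \<open>f \<in> H\<close> by (auto simp: H_def)
    show ?thesis
    proof (cases "sum \<beta> UNIV < 1 + (\<Sum>l\<in>UNIV. N l - 1)")
      case True
      then show ?thesis unfolding f \<Psi>_def by blast
    next
      case False
      \<comment> \<open>The total order of vanishing exceeds the degree of every index of the box;
          the factor \<open>F j\<close> contributes order \<open>0\<close>.\<close>
      have "F j \<in> hardy2" using F[of j] by (simp add: D_infinity_def)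
      then have "vanishes_to_order (sum \<beta> UNIV + 0) (\<lambda>z. tuple_power \<Psi> \<beta> z * F j z)"
        unfolding \<Psi>_def
        by (intro vanishes_to_order_mult vanishes_to_order_tuple_power vanishes_to_order_1_diff_value
            vanishes_to_order_0 \<Phi> hardy2_holomorphic)
      then have "vanishes_to_order (sum \<beta> UNIV) f"
        by (simp add: f times_fun_def)
      then have "trunc_coeffs N f = 0"
        using False H \<open>f \<in> H\<close> by (intro trunc_coeffs_eq_0_of_vanishing) auto
      then show ?thesis by simp
    qed
  qed
  then have "trunc_coeffs N ` H \<subseteq> insert 0 (trunc_coeffs N ` ?G')" by blast
  then have "coeff_space.span (trunc_coeffs N ` H) \<subseteq> coeff_space.span (insert 0 (trunc_coeffs N ` ?G'))"
    by (rule coeff_space.span_mono)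
  moreover have "coeff_space.span (trunc_coeffs N ` ?G') \<subseteq> coeff_space.span (trunc_coeffs N ` H)"
    unfolding H_def \<Psi>_def by (intro coeff_space.span_mono image_mono) blast
  ultimately have "coeff_space.span (trunc_coeffs N ` H) = coeff_space.span (trunc_coeffs N ` ?G')"
    by (simp add: coeff_space.span_insert_0)
  moreover have "coeff_space.span (trunc_coeffs N ` H) = coeff_space.span (trunc_coeffs N ` G)"
    using trunc_coeffs_span[OF H, of N] trunc_coeffs_span[OF G, of N] span by simp
  ultimately show ?thesis
    unfolding M_space_def G_def[symmetric] trunc_coeffs_hardy2_closure_span[OF G] by simp
qed

section \<open>Dimensions in the truncation algebra\<close>

lemma mpoly_ring_simps [simp]:
  "carrier mpoly_ring = (UNIV :: ('d::finite) mpoly set)"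
  "(p :: 'd mpoly) \<oplus>\<^bsub>mpoly_ring\<^esub> q = p + q"
  "p \<otimes>\<^bsub>mpoly_ring\<^esub> q = p * q"
  "\<zero>\<^bsub>mpoly_ring\<^esub> = (0 :: 'd mpoly)"
  "\<one>\<^bsub>mpoly_ring\<^esub> = (1 :: 'd mpoly)"
  by (simp_all add: ring_of_type_algebra_def)

lemma ideal_trunc_ideal: "ideal (trunc_ideal N) (mpoly_ring :: ('d::finite) mpoly ring)"
  unfolding trunc_ideal_def by (intro ring.genideal_ideal ring_from_type_algebra) simp

lemma mult_vanishes_on_box:
  fixes p q :: "('d::finite) mpoly"
  assumes "\<And>\<alpha>. \<alpha> \<in> index_box N \<Longrightarrow> Poly_Mapping.lookup q \<alpha> = 0" and "\<alpha> \<in> index_box N"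
  shows "Poly_Mapping.lookup (p * q) \<alpha> = 0"
proof -
  have "(Poly_Mapping.lookup q \<gamma> when \<alpha> = \<beta> + \<gamma>) = 0" for \<beta> \<gamma>
  proof (cases "\<alpha> = \<beta> + \<gamma>")
    case True
    then have "\<gamma> \<in> index_box N"
      using assms(2) by (auto simp: index_box_def intro: le_less_trans[rotated])
    then show ?thesis using assms(1) by simp
  qed simp
  then show ?thesis by (simp add: lookup_mult)
qed

lemma ideal_vanishing_on_box:
  "ideal {p :: ('d::finite) mpoly. \<forall>\<alpha>\<in>index_box N. Poly_Mapping.lookup p \<alpha> = 0} mpoly_ring"
    (is "ideal ?I _")
proof (rule idealI)
  show r: "ring (mpoly_ring :: 'd mpoly ring)" by (rule ring_from_type_algebra)
  interpret ring "mpoly_ring :: 'd mpoly ring" by (rule r)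
  show "subgroup ?I (add_monoid mpoly_ring)"
  proof (rule add.subgroupI)
    show "\<ominus>\<^bsub>mpoly_ring\<^esub> p \<in> ?I" if "p \<in> ?I" for p
    proof -
      have "\<ominus>\<^bsub>mpoly_ring\<^esub> p = - p" by (rule minus_equality) simp_all
      then show ?thesis using that by simp
    qed
    show "?I \<noteq> {}" by (rule ex_in_conv[THEN iffD1], rule exI[of _ 0]) simp
  qed (auto simp: lookup_add)
  show "p \<otimes>\<^bsub>mpoly_ring\<^esub> q \<in> ?I" if "q \<in> ?I" for p q
    using that mult_vanishes_on_box[of N q] by simp
  show "q \<otimes>\<^bsub>mpoly_ring\<^esub> p \<in> ?I" if "q \<in> ?I" for p q
    using that mult_vanishes_on_box[of N q] by (simp add: mult.commute[of q p])
qed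

text \<open>The polynomials vanishing on the box form an ideal that contains the generators. Conversely, a
  monomial outside the box has some exponent at least \<open>N\<^sub>i\<close> and is a multiple of the corresponding
  generator.\<close>

lemma mem_trunc_ideal_iff:
  fixes p :: "('d::finite) mpoly"
  shows "p \<in> trunc_ideal N \<longleftrightarrow> (\<forall>\<alpha>\<in>index_box N. Poly_Mapping.lookup p \<alpha> = 0)"
proof
  have "Poly_Mapping.lookup (var_power i (N i)) \<alpha> = 0" if "\<alpha> \<in> index_box N" for i \<alpha>
    using that by (auto simp: var_power_def lookup_single when_def index_box_def dest: spec[of _ i])
  then have "trunc_ideal N \<subseteq> {p. \<forall>\<alpha>\<in>index_box N. Poly_Mapping.lookup p \<alpha> = 0}"
    unfolding trunc_ideal_def
    by (intro ring.genideal_minimal ring_from_type_algebra ideal_vanishing_on_box) auto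
  then show "p \<in> trunc_ideal N \<Longrightarrow> \<forall>\<alpha>\<in>index_box N. Poly_Mapping.lookup p \<alpha> = 0" by blast
next
  interpret ideal "trunc_ideal N" "mpoly_ring :: 'd mpoly ring" by (rule ideal_trunc_ideal)
  assume p: "\<forall>\<alpha>\<in>index_box N. Poly_Mapping.lookup p \<alpha> = 0"
  have mono: "Poly_Mapping.single \<alpha> c \<in> trunc_ideal N" if \<alpha>: "\<alpha> \<notin> index_box N" for \<alpha> c
  proof -
    obtain i where i: "N i \<le> \<alpha> i" using \<alpha> by (auto simp: index_box_def not_less)
    have "var_power i (N i) \<in> trunc_ideal N"
      unfolding trunc_ideal_def by (intro set_mp[OF genideal_self]) auto
    then have "Poly_Mapping.single (\<lambda>j. \<alpha> j - (if j = i then N i else 0)) c * var_power i (N i) \<in> trunc_ideal N"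
      using I_l_closed by simp
    moreover have "(\<lambda>j. \<alpha> j - (if j = i then N i else 0)) + (\<lambda>j. if j = i then N i else 0) = \<alpha>"
      using i by (auto simp: fun_eq_iff)
    ultimately show ?thesis by (simp add: var_power_def mult_single)
  qed
  have "(\<Sum>\<alpha>\<in>A. Poly_Mapping.single \<alpha> (Poly_Mapping.lookup p \<alpha>)) \<in> trunc_ideal N" if "A \<subseteq> Poly_Mapping.keys p" for A
  proof -
    have "finite A" using that finite_keys by (rule finite_subset)
    then show ?thesis using that
    proof (induction A rule: finite_induct)
      case empty
      then show ?case using additive_subgroup.zero_closed[OF is_additive_subgroup] by simp
    next
      case (insert \<alpha> A)
      then have "\<alpha> \<notin> index_box N" using p by (auto simp: in_keys_iff)
      then show ?case
        using insert additive_subgroup.a_closed[OF is_additive_subgroup] mono by simp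
    qed
  qed
  moreover have "(\<Sum>\<alpha>\<in>Poly_Mapping.keys p. Poly_Mapping.single \<alpha> (Poly_Mapping.lookup p \<alpha>)) = p"
    by (rule poly_mapping_eqI) (auto simp: lookup_sum lookup_single when_def in_keys_iff)
  ultimately show "p \<in> trunc_ideal N" by (metis order.refl)
qed

lemma trunc_class_eq:
  "trunc_class N q = {p :: ('d::finite) mpoly. \<forall>\<alpha>\<in>index_box N. Poly_Mapping.lookup p \<alpha> = Poly_Mapping.lookup q \<alpha>}"
proof -
  have "p \<in> trunc_class N q \<longleftrightarrow> p - q \<in> trunc_ideal N" for p
  proof -
    have "p \<in> trunc_class N q \<longleftrightarrow> (\<exists>i\<in>trunc_ideal N. p = i + q)"
      by (simp add: trunc_class_def a_r_coset_def')
    also have "\<dots> \<longleftrightarrow> p - q \<in> trunc_ideal N"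
      by (metis add_diff_cancel_right' diff_add_cancel)
    finally show ?thesis .
  qed
  then show ?thesis by (auto simp: mem_trunc_ideal_iff lookup_minus)
qed

lemma trunc_class_eq_iff:
  "trunc_class N p = trunc_class N q \<longleftrightarrow> (\<forall>\<alpha>\<in>index_box N. Poly_Mapping.lookup p \<alpha> = Poly_Mapping.lookup (q :: ('d::finite) mpoly) \<alpha>)"
  unfolding trunc_class_eq by auto

text \<open>The element of the truncation algebra with the given coefficients in the monomial basis.\<close>

definition box_class :: "('d::finite \<Rightarrow> nat) \<Rightarrow> (('d \<Rightarrow> nat) \<Rightarrow> complex) \<Rightarrow> 'd mpoly set" where
  "box_class N v = trunc_class N (\<Sum>\<alpha>\<in>index_box N. Poly_Mapping.single \<alpha> (v \<alpha>))"

lemma lookup_box_sum: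
  "\<beta> \<in> index_box N \<Longrightarrow> Poly_Mapping.lookup (\<Sum>\<alpha>\<in>index_box N. Poly_Mapping.single \<alpha> (v \<alpha>)) \<beta> = v \<beta>"
  by (simp add: lookup_sum lookup_single when_def finite_index_box)

lemma box_class_eq_iff: "box_class N v = box_class N w \<longleftrightarrow> (\<forall>\<alpha>\<in>index_box N. v \<alpha> = w \<alpha>)"
  by (simp add: box_class_def trunc_class_eq_iff lookup_box_sum)

lemma taylor_trunc_eq_box_class: "taylor_trunc N f = box_class N (trunc_coeffs N f)"
  unfolding taylor_trunc_def box_class_def index_box_def[symmetric]
  by (simp add: trunc_coeffs_def)

lemma trunc_class_eq_box_class: "trunc_class N p = box_class N (Poly_Mapping.lookup p)"
  by (simp add: box_class_def trunc_class_eq_iff lookup_box_sum)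

lemma ring_hom_trunc_class: "ring_hom_ring mpoly_ring (trunc_algebra N) (trunc_class (N :: 'd::finite \<Rightarrow> nat))"
  using ideal.rcos_ring_hom_ring[OF ideal_trunc_ideal[of N]]
  by (simp add: trunc_algebra_def trunc_class_def[abs_def])

lemma carrier_trunc_algebra: "carrier (trunc_algebra N) = range (box_class (N :: 'd::finite \<Rightarrow> nat))"
proof -
  have "carrier (trunc_algebra N) = range (trunc_class N)"
    by (auto simp: trunc_algebra_def FactRing_def A_RCOSETS_def' trunc_class_def)
  also have "\<dots> = range (box_class N)"
  proof (intro subset_antisym image_subsetI)
    show "trunc_class N p \<in> range (box_class N)" for p
      by (rule image_eqI[where x = "Poly_Mapping.lookup p"]) (simp_all add: trunc_class_eq_box_class)
    show "box_class N v \<in> range (trunc_class N)" for v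
      unfolding box_class_def by (rule imageI) simp
  qed
  finally show ?thesis .
qed

lemma box_class_add:
  "box_class N v \<oplus>\<^bsub>trunc_algebra N\<^esub> box_class N w = box_class (N :: 'd::finite \<Rightarrow> nat) (v + w)"
proof -
  interpret ring_hom_ring mpoly_ring "trunc_algebra N" "trunc_class N" by (rule ring_hom_trunc_class)
  show ?thesis
    by (simp add: box_class_def hom_add[symmetric] single_add sum.distrib)
qed

lemma box_class_cmult:
  "trunc_class N (Poly_Mapping.single 0 c) \<otimes>\<^bsub>trunc_algebra N\<^esub> box_class N v
     = box_class (N :: 'd::finite \<Rightarrow> nat) (\<lambda>\<alpha>. c * v \<alpha>)"
proof -
  interpret ring_hom_ring mpoly_ring "trunc_algebra N" "trunc_class N" by (rule ring_hom_trunc_class)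
  show ?thesis
    by (simp add: box_class_def hom_mult[symmetric] mult_single sum_distrib_left)
qed

lemma box_class_0: "\<zero>\<^bsub>trunc_algebra N\<^esub> = box_class (N :: 'd::finite \<Rightarrow> nat) 0"
proof -
  interpret ring_hom_ring mpoly_ring "trunc_algebra N" "trunc_class N" by (rule ring_hom_trunc_class)
  show ?thesis using hom_zero by (simp add: box_class_def)
qed

text \<open>The scalars are a homomorphic image of the field \<open>\<complex>\<close>, and the quotient is nonzero because the
  exponent \<open>0\<close> lies in the box.\<close>

lemma subfield_trunc_scalars:
  assumes N: "\<And>l. N l > 0"
  shows "subfield (trunc_scalars N) (trunc_algebra (N :: 'd::finite \<Rightarrow> nat))"
proof -
  interpret T: ring_hom_ring mpoly_ring "trunc_algebra N" "trunc_class N" by (rule ring_hom_trunc_class)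
  let ?C = "ring_of_type_algebra :: complex ring"
  interpret C: field ?C by (rule field_from_type_algebra)
  have "(\<lambda>c. Poly_Mapping.single 0 c) \<in> ring_hom ?C (mpoly_ring :: 'd mpoly ring)"
    by (rule ring_hom_memI) (auto simp: ring_of_type_algebra_def single_add mult_single)
  then have "trunc_class N \<circ> Poly_Mapping.single 0 \<in> ring_hom ?C (trunc_algebra N)"
    using T.homh by (rule ring_hom_trans)
  then interpret h: ring_hom_ring ?C "trunc_algebra N" "trunc_class N \<circ> Poly_Mapping.single 0"
    by (intro ring_hom_ringI2 C.ring_axioms T.S.ring_axioms)
  have "trunc_class N 1 \<noteq> trunc_class N 0"
    unfolding trunc_class_eq_iff using N by (auto simp: index_box_def lookup_one when_def intro!: exI[of _ 0])
  then have "\<one>\<^bsub>trunc_algebra N\<^esub> \<noteq> \<zero>\<^bsub>trunc_algebra N\<^esub>"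
    using T.hom_one T.hom_zero by simp
  then have "subfield ((trunc_class N \<circ> Poly_Mapping.single 0) ` carrier ?C) (trunc_algebra N)"
    by (rule h.img_is_subfield(2)[OF C.carrier_is_subfield])
  moreover have "(trunc_class N \<circ> Poly_Mapping.single 0) ` carrier ?C = trunc_scalars N"
    by (auto simp: trunc_scalars_def ring_of_type_algebra_def)
  ultimately show ?thesis by simp
qed

text \<open>The span in the quotient algebra over its field of scalars is the image of the complex span of
  coefficient families.\<close>

lemma Span_box_class:
  fixes N :: "'d::finite \<Rightarrow> nat"
  shows "ring.Span (trunc_algebra N) (trunc_scalars N) (map (box_class N) vs) = box_class N ` coeff_space.span (set vs)"
proof -
  interpret T: ring_hom_ring mpoly_ring "trunc_algebra N" "trunc_class N" by (rule ring_hom_trunc_class)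
  show ?thesis
  proof (induction vs)
    case Nil
    then show ?case by (simp add: box_class_0 zero_fun_def)
  next
    case (Cons u us)
    have ext: "T.S.line_extension (trunc_scalars N) (box_class N u) (box_class N ` coeff_space.span (set us))
        = box_class N ` coeff_space.span (insert u (set us))"
    proof (intro subset_antisym subsetI)
      fix x assume "x \<in> T.S.line_extension (trunc_scalars N) (box_class N u) (box_class N ` coeff_space.span (set us))"
      then obtain c w where w: "w \<in> coeff_space.span (set us)" and "x = box_class N ((\<lambda>\<alpha>. c * u \<alpha>) + w)"
        unfolding T.S.line_extension_mem_iff trunc_scalars_def by (auto simp: box_class_cmult box_class_add)
      moreover have "(\<lambda>\<alpha>. c * u \<alpha>) + w \<in> coeff_space.span (insert u (set us))"
        unfolding coeff_space.span_insert using w by (auto intro!: exI[of _ c])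
      ultimately show "x \<in> box_class N ` coeff_space.span (insert u (set us))" by blast
    next
      fix x assume "x \<in> box_class N ` coeff_space.span (insert u (set us))"
      then obtain v c where x: "x = box_class N v" and v: "v - (\<lambda>\<alpha>. c * u \<alpha>) \<in> coeff_space.span (set us)"
        unfolding coeff_space.span_insert by blast
      have "x = trunc_class N (Poly_Mapping.single 0 c) \<otimes>\<^bsub>trunc_algebra N\<^esub> box_class N u
          \<oplus>\<^bsub>trunc_algebra N\<^esub> box_class N (v - (\<lambda>\<alpha>. c * u \<alpha>))"
        by (simp add: x box_class_cmult box_class_add)
      then show "x \<in> T.S.line_extension (trunc_scalars N) (box_class N u) (box_class N ` coeff_space.span (set us))"
        unfolding T.S.line_extension_mem_iff trunc_scalars_def using v by blast
    qed
    show ?case using Cons.IH ext by simp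
  qed
qed

text \<open>Families supported in the box are determined by their classes, so linear independence carries over
  to the truncation algebra.\<close>

lemma dim_box_class_span:
  fixes N :: "'d::finite \<Rightarrow> nat"
  assumes N: "\<And>l. N l > 0" and B: "finite B" "coeff_space.independent B"
    and supp: "\<And>v \<alpha>. v \<in> B \<Longrightarrow> \<alpha> \<notin> index_box N \<Longrightarrow> v \<alpha> = 0"
  shows "ring.dim (trunc_algebra N) (trunc_scalars N) (box_class N ` coeff_space.span B) = card B"
proof -
  interpret T: ring_hom_ring mpoly_ring "trunc_algebra N" "trunc_class N" by (rule ring_hom_trunc_class)
  note K = subfield_trunc_scalars[of N, OF N]
  have suppspan: "v \<alpha> = 0" if "v \<in> coeff_space.span B" "\<alpha> \<notin> index_box N" for v \<alpha>
  proof -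
    have "coeff_space.span B \<subseteq> {v. v \<alpha> = 0}"
      using supp that(2) by (intro coeff_space.span_minimal coeff_space.subspaceI) auto
    then show ?thesis using that(1) by auto
  qed
  have inj: "v = w" if "v \<in> coeff_space.span B" "w \<in> coeff_space.span B" "box_class N v = box_class N w" for v w
  proof
    show "v \<alpha> = w \<alpha>" for \<alpha>
      using that suppspan[of v \<alpha>] suppspan[of w \<alpha>] by (cases "\<alpha> \<in> index_box N") (auto simp: box_class_eq_iff)
  qed
  have ind: "T.S.independent (trunc_scalars N) (map (box_class N) vs)" if "distinct vs" "set vs \<subseteq> B" for vs
    using that
  proof (induction vs)
    case Nil
    then show ?case by simp
  next
    case (Cons u us)
    have "box_class N u \<notin> box_class N ` coeff_space.span (set us)"
    proof
      assume "box_class N u \<in> box_class N ` coeff_space.span (set us)"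
      then obtain w where w: "w \<in> coeff_space.span (set us)" "box_class N u = box_class N w" by blast
      have "w \<in> coeff_space.span B" using w(1) coeff_space.span_mono[of "set us" B] Cons.prems by auto
      then have "u = w" using inj[of u w] w(2) Cons.prems coeff_space.span_base[of u B] by auto
      then have "u \<in> coeff_space.span (B - {u})"
        using w(1) coeff_space.span_mono[of "set us" "B - {u}"] Cons.prems by auto
      then show False using B(2) Cons.prems by (auto simp: coeff_space.dependent_def)
    qed
    then show ?case
      using Cons unfolding list.map
      by (intro T.S.independent.li_Cons) (auto simp: carrier_trunc_algebra Span_box_class[unfolded T.S.Span.simps])
  qed
  obtain vs where vs: "set vs = B" "distinct vs" using finite_distinct_list[OF B(1)] by blast
  have "T.S.dimension (length (map (box_class N) vs)) (trunc_scalars N) (box_class N ` coeff_space.span B)"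
    using T.S.dimensionI[OF K ind[of vs]] vs Span_box_class[of N vs] by simp
  then show ?thesis
    unfolding T.S.dim_def using T.S.dimension_is_inj[OF K] vs distinct_card[of vs] by (auto intro!: the_equality)
qed

text \<open>The unit families at the indices of the box form a basis.\<close>

lemma dim_trunc_algebra:
  fixes N :: "'d::finite \<Rightarrow> nat"
  assumes N: "\<And>l. N l > 0"
  shows "ring.dim (trunc_algebra N) (trunc_scalars N) (carrier (trunc_algebra N)) = (\<Prod>l\<in>UNIV. N l)"
proof -
  define e where "e = (\<lambda>\<alpha> :: 'd \<Rightarrow> nat. (\<lambda>\<beta>. if \<beta> = \<alpha> then 1 else 0 :: complex))"
  have inj: "inj e" by (rule injI) (metis e_def zero_neq_one)
  have "coeff_space.independent (e ` index_box N)"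
    unfolding coeff_space.dependent_def
  proof
    assume "\<exists>a\<in>e ` index_box N. a \<in> coeff_space.span (e ` index_box N - {a})"
    then obtain \<alpha> where \<alpha>: "e \<alpha> \<in> coeff_space.span (e ` index_box N - {e \<alpha>})" by blast
    have "coeff_space.span (e ` index_box N - {e \<alpha>}) \<subseteq> {v. v \<alpha> = 0}"
      by (intro coeff_space.span_minimal coeff_space.subspaceI) (auto simp: e_def)
    then have "e \<alpha> \<alpha> = 0" using \<alpha> by blast
    then show False by (simp add: e_def)
  qed
  then have "ring.dim (trunc_algebra N) (trunc_scalars N) (box_class N ` coeff_space.span (e ` index_box N)) = card (e ` index_box N)"
    by (intro dim_box_class_span N finite_imageI finite_index_box) (auto simp: e_def)
  moreover have "box_class N ` coeff_space.span (e ` index_box N) = range (box_class N)"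
  proof -
    have "box_class N v \<in> box_class N ` coeff_space.span (e ` index_box N)" for v
    proof (rule image_eqI)
      show "(\<Sum>\<alpha>\<in>index_box N. (\<lambda>\<beta>. v \<alpha> * e \<alpha> \<beta>)) \<in> coeff_space.span (e ` index_box N)"
        by (intro coeff_space.span_sum coeff_space.span_scale coeff_space.span_base) blast
      show "box_class N v = box_class N (\<Sum>\<alpha>\<in>index_box N. (\<lambda>\<beta>. v \<alpha> * e \<alpha> \<beta>))"
        by (simp add: box_class_eq_iff sum_fun_apply e_def finite_index_box if_distrib cong: if_cong)
    qed
    then show ?thesis by blast
  qed
  ultimately show ?thesis
    by (simp add: carrier_trunc_algebra card_index_box card_image inj_on_subset[OF inj])
qed

lemma dim_box_class_span_le:
  fixes N :: "'d::finite \<Rightarrow> nat"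
  assumes N: "\<And>l. N l > 0" and S: "finite S" "\<And>v \<alpha>. v \<in> S \<Longrightarrow> \<alpha> \<notin> index_box N \<Longrightarrow> v \<alpha> = 0"
  shows "ring.dim (trunc_algebra N) (trunc_scalars N) (box_class N ` coeff_space.span S) \<le> card S"
proof -
  obtain T where T: "T \<subseteq> S" "coeff_space.independent T" "S \<subseteq> coeff_space.span T"
    using coeff_space.maximal_independent_subset by blast
  have "coeff_space.span T = coeff_space.span S"
    using T by (simp add: coeff_space.span_eq subset_trans[OF T(1) coeff_space.span_superset])
  moreover have "v \<alpha> = 0" if "v \<in> T" "\<alpha> \<notin> index_box N" for v \<alpha>
    using that T(1) S(2) by blast
  ultimately have "ring.dim (trunc_algebra N) (trunc_scalars N) (box_class N ` coeff_space.span S) = card T"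
    using dim_box_class_span[of N T, OF N finite_subset[OF T(1) S(1)] T(2)] by simp
  then show ?thesis using card_mono[OF S(1) T(1)] by simp
qed

section \<open>Counting generators\<close>

text \<open>Listing the values of \<open>\<beta>\<close> and adding the slack \<open>n - \<bar>\<beta>\<bar>\<close> as a last entry gives an injection into
  the lists of length \<open>q + 1\<close> with sum \<open>n\<close>.\<close>

lemma card_multi_indices_le:
  "finite {\<beta> :: 'q::finite \<Rightarrow> nat. sum \<beta> UNIV \<le> n}"
  "card {\<beta> :: 'q::finite \<Rightarrow> nat. sum \<beta> UNIV \<le> n} \<le> (n + CARD('q)) choose CARD('q)"
proof -
  let ?A = "{\<beta> :: 'q \<Rightarrow> nat. sum \<beta> UNIV \<le> n}"
  obtain xs :: "'q list" where xs: "set xs = UNIV" "distinct xs" 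
    using finite_distinct_list[OF finite] by blast
  have len: "length xs = CARD('q)" using xs distinct_card by fastforce
  define f where "f = (\<lambda>\<beta> :: 'q \<Rightarrow> nat. map \<beta> xs @ [n - sum \<beta> UNIV])"
  let ?L = "{l :: nat list. length l = CARD('q) + 1 \<and> sum_list l = n}"
  have card: "card ?L = (n + CARD('q)) choose CARD('q)"
    using card_length_sum_list[of "CARD('q) + 1" n] binomial_symmetric[of n "n + CARD('q)"] by simp
  then have fin: "finite ?L" by (intro card_ge_0_finite) simp
  have inj: "inj_on f ?A"
    by (rule inj_onI) (use xs in \<open>auto simp: f_def fun_eq_iff\<close>)
  have sub: "f ` ?A \<subseteq> ?L"
    using len xs by (auto simp: f_def sum_list_distinct_conv_sum_set)
  show "finite ?A" by (rule inj_on_finite[OF inj sub fin])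
  show "card ?A \<le> (n + CARD('q)) choose CARD('q)"
    using card_inj_on_le[OF inj sub fin] card by simp
qed

theorem proposition3p4:
  fixes \<Phi> :: "'q::finite \<Rightarrow> complex ^ 'd::finite \<Rightarrow> complex"
    and F :: "'r::finite \<Rightarrow> complex ^ 'd \<Rightarrow> complex"
    and N :: "'d \<Rightarrow> nat"
  assumes "CARD('q) < CARD('d)"
    and "\<And>l. holomorphic_on_polydisk (\<Phi> l)"
    and "\<And>j. F j \<in> D_infinity \<Phi>"
    and "\<And>l. N l > 0"
  defines "L \<equiv> 1 + (\<Sum>l\<in>UNIV. N l - 1)"
  shows "int (trunc_codim N (taylor_trunc N ` M_space \<Phi> F))
           \<ge> int (\<Prod>l\<in>UNIV. N l) - int CARD('r) * int ((L + CARD('q) - 1) choose CARD('q))"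
proof -
  define n where "n = (\<Sum>l\<in>UNIV. N l - 1)"
  define P where "P = {\<beta> :: 'q \<Rightarrow> nat. sum \<beta> UNIV \<le> n} \<times> (UNIV :: 'r set)"
  define g where "g = (\<lambda>(\<beta>, j). trunc_coeffs N (tuple_power (\<lambda>l z. \<Phi> l z - \<Phi> l 0) \<beta> * F j))"
  have finP: "finite P" unfolding P_def using card_multi_indices_le(1) by (rule finite_SigmaI) simp
  have "trunc_coeffs N ` {tuple_power (\<lambda>l z. \<Phi> l z - \<Phi> l 0) \<beta> * F j | \<beta> j. sum \<beta> UNIV < 1 + (\<Sum>l\<in>UNIV. N l - 1)} = g ` P"
    unfolding g_def P_def n_def by (auto simp: image_iff less_Suc_eq_le) 
  then have "taylor_trunc N ` M_space \<Phi> F = box_class N ` coeff_space.span (g ` P)"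
    using trunc_coeffs_M_space[of \<Phi> F N, OF assms(2,3)]
    by (simp add: taylor_trunc_eq_box_class image_image[symmetric, of "box_class N" "trunc_coeffs N"])
  moreover have "ring.dim (trunc_algebra N) (trunc_scalars N) (box_class N ` coeff_space.span (g ` P)) \<le> card (g ` P)"
    by (rule dim_box_class_span_le[OF assms(4) finite_imageI[OF finP]]) (auto simp: g_def trunc_coeffs_def)
  ultimately have "ring.dim (trunc_algebra N) (trunc_scalars N) (taylor_trunc N ` M_space \<Phi> F) \<le> card (g ` P)"
    by simp
  also have "\<dots> \<le> card P" by (rule card_image_le[OF finP])
  also have "\<dots> \<le> ((L + CARD('q) - 1) choose CARD('q)) * CARD('r)"
    using card_multi_indices_le(2)[of n, where 'q = 'q]
    by (simp add: P_def card_cartesian_product L_def n_def)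
  finally have "int (ring.dim (trunc_algebra N) (trunc_scalars N) (taylor_trunc N ` M_space \<Phi> F))
      \<le> int CARD('r) * int ((L + CARD('q) - 1) choose CARD('q))"
    by (simp only: of_nat_mult[symmetric] of_nat_le_iff mult.commute)
  then show ?thesis
    unfolding trunc_codim_def dim_trunc_algebra[of N, OF assms(4)] by linarith
qed

end
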